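(* Let $\delta, \eta > 0$, and let $T : SL^\infty\to SL^\infty$ be a bounded linear operator satisfying $$|\langle T h_I, h_I \rangle| \geq \delta |I| \qquad \text{for all } I\in \mathcal D.$$ Then the identity operator $\mathrm{Id}$ on $SL^\infty$ factors through $T$, that is, there are bounded linear operators $R, S : SL^\infty\to SL^\infty$ such that $S\,T\,R = \mathrm{Id}$. Moreover, the operators $R$ and $S$ can be chosen with $\|R\|\,\|S\| \leq (1+\eta)/\delta$.
   Context: $\mathcal D$ denotes the collection of dyadic subintervals $[k2^{-n},(k+1)2^{-n})$, $n\ge 0$, $0\le k<2^n$, of $[0,1)$; $|\cdot|$ is Lebesgue measure. For $I\in\mathcal D$, $h_I$ is the $L^\infty$-normalized Haar function: $h_I=+1$ on the left half of $I$, $-1$ on the right half of $I$, and $0$ elsewhere. All scalars are real. $SL^\infty$ is the (non-separable) Banach space of all formal series $f=\sum_{I\in\mathcal D} a_I h_I$ (identified with the coefficient family $(a_I)$; no convergence is implied) with finite norm $$\|f\|_{SL^\infty}=\Big\|\Big(\sum_{I\in\mathcal D} a_I^2 h_I^2\Big)^{1/2}\Big\|_{L^\infty}.$$ For $f=\sum a_I h_I$ and a Haar function $h_J$, the pairing is $\langle f,h_J\rangle = a_J|J|$. *)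

theory Defs
  imports "HOL-Analysis.Analysis" "HOL-Probability.Essential_Supremum"
begin

section \<open>Dyadic intervals and Haar functions\<close>

definition dyadic_intervals :: "real set set" where
  "dyadic_intervals = {{real k / 2 ^ n ..< real (k + 1) / 2 ^ n} | n k. k < 2 ^ n}"

definition left_half :: "real set \<Rightarrow> real set" where
  "left_half I = {x \<in> I. x < (Inf I + Sup I) / 2}"

definition right_half :: "real set \<Rightarrow> real set" where
  "right_half I = {x \<in> I. (Inf I + Sup I) / 2 \<le> x}"

definition haar :: "real set \<Rightarrow> real \<Rightarrow> real" where
  "haar I x = indicator (left_half I) x - indicator (right_half I) x"

lemma left_half_interval: "a < b \<Longrightarrow> left_half {a..<b} = {a..<(a + b) / 2}"
  by (auto simp: left_half_def)

lemma right_half_interval: "a < b \<Longrightarrow> right_half {a..<b} = {(a + b) / 2..<b}"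
  by (auto simp: right_half_def)

lemma countable_dyadic_intervals: "countable dyadic_intervals"
proof -
  have "dyadic_intervals \<subseteq> (\<lambda>(n, k). {real k / 2 ^ n ..< real (k + 1) / 2 ^ n}) ` (UNIV :: (nat \<times> nat) set)"
    unfolding dyadic_intervals_def by auto
  then show ?thesis
    by (rule countable_subset) auto
qed

lemma dyadic_intervalsE:
  assumes "I \<in> dyadic_intervals"
  obtains a b where "I = {a..<b}" "0 \<le> a" "a < b" "b \<le> 1"
proof -
  from assms obtain n k where I: "I = {real k / 2 ^ n ..< real (k + 1) / 2 ^ n}" and k: "k < 2 ^ n"
    unfolding dyadic_intervals_def by blast
  have "real (k + 1) \<le> real (2 ^ n)"
    using k by (subst of_nat_le_iff) simp
  then have "real (k + 1) / 2 ^ n \<le> 1"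
    by simp
  moreover have "real k / 2 ^ n < real (k + 1) / 2 ^ n"
    by (simp add: divide_strict_right_mono)
  ultimately show ?thesis
    using that[OF I] by simp
qed

lemma haar_measurable: "I \<in> dyadic_intervals \<Longrightarrow> haar I \<in> borel_measurable borel"
  by (elim dyadic_intervalsE, unfold haar_def[abs_def]) (simp add: left_half_interval right_half_interval)

lemma haar_square: "(haar I x)\<^sup>2 = indicator I x"
  by (auto simp: haar_def left_half_def right_half_def indicator_def)


section \<open>The square function\<close>

definition ennsqrt :: "ennreal \<Rightarrow> ennreal" where
  "ennsqrt x = (if x = top then top else ennreal (sqrt (enn2real x)))"

definition square_function :: "(real set \<Rightarrow> real) \<Rightarrow> real \<Rightarrow> ennreal" where
  "square_function a x = ennsqrt (\<Sum>\<^sub>\<infinity>I\<in>dyadic_intervals. ennreal ((a I)\<^sup>2 * (haar I x)\<^sup>2))"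

text \<open>For a nonmeasurable function \<^const>\<open>esssup\<close> is \<open>top\<close> by convention; square functions
  are always measurable, see \<open>square_function_measurable\<close> below.\<close>

definition SL_ennorm :: "(real set \<Rightarrow> real) \<Rightarrow> ennreal" where
  "SL_ennorm a = esssup (lebesgue_on {0..<1}) (square_function a)"

lemma ennsqrt_ennreal: "0 \<le> r \<Longrightarrow> ennsqrt (ennreal r) = ennreal (sqrt r)"
  by (simp add: ennsqrt_def)

lemma ennsqrt_mono: "x \<le> y \<Longrightarrow> ennsqrt x \<le> ennsqrt y"
  by (cases x; cases y) (auto simp: ennsqrt_def top_unique)

lemma ennsqrt_le_iff: "ennsqrt x \<le> ennreal c \<longleftrightarrow> x \<le> ennreal (c\<^sup>2)" if "0 \<le> c" for c
proof (cases x)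
  case (real r)
  then show ?thesis
    using that by (simp add: ennsqrt_ennreal ennreal_le_iff real_sqrt_le_iff')
qed (auto simp: ennsqrt_def top_unique)

lemma ennsqrt_measurable [measurable]: "ennsqrt \<in> borel_measurable borel"
  unfolding ennsqrt_def[abs_def] by measurable

lemma infsum_ennreal_SUP:
  fixes f :: "'a \<Rightarrow> ennreal"
  shows "infsum f A = (SUP F\<in>{F. finite F \<and> F \<subseteq> A}. sum f F)"
  by (rule nonneg_infsum_complete) simp

lemma sum_ennreal_square:
  "(\<Sum>I\<in>F. ennreal ((a I)\<^sup>2 * (haar I x)\<^sup>2)) = ennreal ((L2_set (\<lambda>I. a I * haar I x) F)\<^sup>2)"
  by (simp add: L2_set_def sum_nonneg power_mult_distrib)

lemma square_function_le_iff:
  assumes "0 \<le> c"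
  shows "square_function a x \<le> ennreal c \<longleftrightarrow>
    (\<forall>F. finite F \<and> F \<subseteq> dyadic_intervals \<longrightarrow> L2_set (\<lambda>I. a I * haar I x) F \<le> c)"
  unfolding square_function_def ennsqrt_le_iff[OF assms] infsum_ennreal_SUP SUP_le_iff
    sum_ennreal_square using assms
  by (auto simp: ennreal_le_iff power_mono_iff L2_set_nonneg)

lemma square_function_measurable: "square_function a \<in> borel_measurable borel"
proof -
  have "(\<lambda>x. SUP F\<in>{F. finite F \<and> F \<subseteq> dyadic_intervals}. \<Sum>I\<in>F. ennreal ((a I)\<^sup>2 * (haar I x)\<^sup>2))
      \<in> borel_measurable borel"
    using haar_measurable
    by (intro borel_measurable_SUP countable_Collect_finite_subset countable_dyadic_intervals
        borel_measurable_sum) auto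
  then show ?thesis
    unfolding square_function_def[abs_def] infsum_ennreal_SUP by measurable
qed

lemma square_function_measurable' [measurable]:
  "square_function a \<in> borel_measurable (lebesgue_on {0..<1})"
  by (intro measurable_restrict_space1 measurable_completion) (simp add: square_function_measurable)

lemma SL_ennorm_le_iff: "SL_ennorm a \<le> c \<longleftrightarrow> (AE x in lebesgue_on {0..<1}. square_function a x \<le> c)"
proof
  assume "SL_ennorm a \<le> c"
  with esssup_AE[of "square_function a" "lebesgue_on {0..<1}"]
  show "AE x in lebesgue_on {0..<1}. square_function a x \<le> c"
    by (auto simp: SL_ennorm_def elim!: eventually_mono intro: order_trans)
qed (simp add: SL_ennorm_def esssup_I)

lemma square_function_zero: "square_function (\<lambda>_. 0) x = 0"
  by (simp add: square_function_def ennsqrt_def)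

lemma square_function_add:
  "square_function (\<lambda>I. a I + b I) x \<le> square_function a x + square_function b x"
proof (cases "square_function a x"; cases "square_function b x")
  fix r s assume r: "0 \<le> r" "square_function a x = ennreal r"
    and s: "0 \<le> s" "square_function b x = ennreal s"
  have "L2_set (\<lambda>I. (a I + b I) * haar I x) F \<le> r + s" if "finite F" "F \<subseteq> dyadic_intervals" for F
  proof -
    have "L2_set (\<lambda>I. a I * haar I x + b I * haar I x) F
        \<le> L2_set (\<lambda>I. a I * haar I x) F + L2_set (\<lambda>I. b I * haar I x) F"
      by (rule L2_set_triangle_ineq)
    moreover have "L2_set (\<lambda>I. a I * haar I x) F \<le> r" "L2_set (\<lambda>I. b I * haar I x) F \<le> s"
      using square_function_le_iff[of r a x] square_function_le_iff[of s b x] r s that by auto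
    ultimately show ?thesis
      by (simp add: distrib_right)
  qed
  then have "square_function (\<lambda>I. a I + b I) x \<le> ennreal (r + s)"
    using r s by (subst square_function_le_iff) auto
  then show ?thesis
    using r s by simp
qed auto

lemma square_function_scale_le:
  "square_function (\<lambda>I. r * a I) x \<le> ennreal \<bar>r\<bar> * square_function a x"
proof (cases "square_function a x")
  case (real s)
  have "L2_set (\<lambda>I. r * a I * haar I x) F \<le> \<bar>r\<bar> * s" if "finite F" "F \<subseteq> dyadic_intervals" for F
  proof -
    have "L2_set (\<lambda>I. r * a I * haar I x) F = L2_set (\<lambda>I. \<bar>r\<bar> * (a I * haar I x)) F"
      by (simp add: L2_set_def power_mult_distrib mult.assoc)
    also have "\<dots> = \<bar>r\<bar> * L2_set (\<lambda>I. a I * haar I x) F"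
      by (simp add: L2_set_right_distrib)
    also have "\<dots> \<le> \<bar>r\<bar> * s"
      using square_function_le_iff[of s a x] real that by (intro mult_left_mono) auto
    finally show ?thesis .
  qed
  then have "square_function (\<lambda>I. r * a I) x \<le> ennreal (\<bar>r\<bar> * s)"
    using real by (subst square_function_le_iff) auto
  then show ?thesis
    using real by (simp add: ennreal_mult)
next
  case top
  then show ?thesis
    by (cases "r = 0") (auto simp: square_function_zero ennreal_mult_top)
qed

lemma SL_ennorm_zero: "SL_ennorm (\<lambda>_. 0) = 0"
  using SL_ennorm_le_iff[of "\<lambda>_. 0" 0] by (simp add: square_function_zero)

lemma SL_ennorm_add: "SL_ennorm (\<lambda>I. a I + b I) \<le> SL_ennorm a + SL_ennorm b"
proof -
  have "AE x in lebesgue_on {0..<1}. square_function a x \<le> SL_ennorm a"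
    "AE x in lebesgue_on {0..<1}. square_function b x \<le> SL_ennorm b"
    using SL_ennorm_le_iff by blast+
  then have "AE x in lebesgue_on {0..<1}.
      square_function (\<lambda>I. a I + b I) x \<le> SL_ennorm a + SL_ennorm b"
    by eventually_elim (rule order_trans[OF square_function_add add_mono])
  then show ?thesis
    by (simp add: SL_ennorm_le_iff[of "\<lambda>I. a I + b I"])
qed

lemma SL_ennorm_scale_le: "SL_ennorm (\<lambda>I. r * a I) \<le> ennreal \<bar>r\<bar> * SL_ennorm a"
proof -
  have "AE x in lebesgue_on {0..<1}. square_function a x \<le> SL_ennorm a"
    using SL_ennorm_le_iff by blast
  then have "AE x in lebesgue_on {0..<1}.
      square_function (\<lambda>I. r * a I) x \<le> ennreal \<bar>r\<bar> * SL_ennorm a"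
    by eventually_elim (rule order_trans[OF square_function_scale_le mult_left_mono], simp_all)
  then show ?thesis
    by (simp add: SL_ennorm_le_iff[of "\<lambda>I. r * a I"])
qed

lemma SL_ennorm_scale: "SL_ennorm (\<lambda>I. r * a I) = ennreal \<bar>r\<bar> * SL_ennorm a"
proof (cases "r = 0")
  case False
  have "ennreal \<bar>r\<bar> * SL_ennorm a = ennreal \<bar>r\<bar> * SL_ennorm (\<lambda>I. (1 / r) * (r * a I))"
    using False by simp
  also have "\<dots> \<le> ennreal \<bar>r\<bar> * (ennreal \<bar>1 / r\<bar> * SL_ennorm (\<lambda>I. r * a I))"
    by (intro mult_left_mono SL_ennorm_scale_le) simp
  also have "\<dots> = SL_ennorm (\<lambda>I. r * a I)"
    using False by (simp add: mult.assoc[symmetric] ennreal_mult[symmetric])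
  finally show ?thesis
    using SL_ennorm_scale_le[of r a] by simp
qed (simp add: SL_ennorm_zero)

lemma abs_coeff_le_SL_ennorm:
  assumes "J \<in> dyadic_intervals"
  shows "ennreal \<bar>a J\<bar> \<le> SL_ennorm a"
proof -
  obtain l u where J: "J = {l..<u}" "0 \<le> l" "l < u" "u \<le> 1"
    using assms by (rule dyadic_intervalsE)
  have ae: "AE x in lebesgue_on {0..<1}. square_function a x \<le> SL_ennorm a"
    using SL_ennorm_le_iff by blast
  have "\<exists>x\<in>J. square_function a x \<le> SL_ennorm a"
  proof (rule ccontr)
    assume "\<not> ?thesis"
    then have "AE x in lebesgue. x \<notin> J"
      using ae J by (auto simp: AE_restrict_space_iff elim!: eventually_mono)
    then have "emeasure lebesgue J = 0"
      using AE_iff_measurable[of J lebesgue "\<lambda>x. x \<notin> J"] J by (simp del: atLeastLessThan_iff)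
    then show False
      using J by simp
  qed
  then obtain x where x: "x \<in> J" "square_function a x \<le> SL_ennorm a" by blast
  have "ennreal \<bar>a J\<bar> \<le> square_function a x"
  proof (cases "square_function a x")
    case (real s)
    then have "L2_set (\<lambda>I. a I * haar I x) {J} \<le> s"
      using square_function_le_iff[of s a x] assms by auto
    moreover have "\<bar>haar J x\<bar> = 1"
      using haar_square[of J x] x by (auto simp: power2_eq_1_iff)
    ultimately show ?thesis
      using real by (simp add: L2_set_def abs_mult ennreal_le_iff)
  qed simp
  with x show ?thesis by simp
qed


section \<open>The space \<open>SL\<^sup>\<infinity>\<close>\<close>

text \<open>A formal series is its coefficient family. Families are indexed by all sets of reals and
  required to vanish off \<^const>\<open>dyadic_intervals\<close>, so that equality in the type is equality of the
  coefficients over dyadic intervals.\<close>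

typedef SL_inf = "{a :: real set \<Rightarrow> real. (\<forall>I. I \<notin> dyadic_intervals \<longrightarrow> a I = 0) \<and> SL_ennorm a < top}"
  morphisms coeff Abs_SL_inf
  by (rule exI[of _ "\<lambda>_. 0"]) (simp add: SL_ennorm_zero)

setup_lifting type_definition_SL_inf

instantiation SL_inf :: real_normed_vector
begin

lift_definition zero_SL_inf :: SL_inf is "\<lambda>_. 0"
  by (simp add: SL_ennorm_zero)

lift_definition plus_SL_inf :: "SL_inf \<Rightarrow> SL_inf \<Rightarrow> SL_inf" is "\<lambda>a b I. a I + b I"
  by (auto intro: order.strict_trans1[OF SL_ennorm_add])

lift_definition scaleR_SL_inf :: "real \<Rightarrow> SL_inf \<Rightarrow> SL_inf" is "\<lambda>r a I. r * a I"
  by (auto simp: SL_ennorm_scale ennreal_mult_less_top)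

definition uminus_SL_inf :: "SL_inf \<Rightarrow> SL_inf" where
  "uminus_SL_inf f = (- 1) *\<^sub>R f"

definition minus_SL_inf :: "SL_inf \<Rightarrow> SL_inf \<Rightarrow> SL_inf" where
  "minus_SL_inf f g = f + - g"

lift_definition norm_SL_inf :: "SL_inf \<Rightarrow> real" is "\<lambda>a. enn2real (SL_ennorm a)" .

definition sgn_SL_inf :: "SL_inf \<Rightarrow> SL_inf" where
  "sgn_SL_inf f = inverse (norm f) *\<^sub>R f"

definition dist_SL_inf :: "SL_inf \<Rightarrow> SL_inf \<Rightarrow> real" where
  "dist_SL_inf f g = norm (f - g)"

definition uniformity_SL_inf :: "(SL_inf \<times> SL_inf) filter" where
  "uniformity_SL_inf = (INF e\<in>{0<..}. principal {(f, g). dist f g < e})"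

definition open_SL_inf :: "SL_inf set \<Rightarrow> bool" where
  "open_SL_inf U \<longleftrightarrow> (\<forall>f\<in>U. \<forall>\<^sub>F (f', g) in uniformity. f' = f \<longrightarrow> g \<in> U)"

instance
proof
  fix f g h :: SL_inf and r s :: real
  show "f + g + h = f + (g + h)" "f + g = g + f" "0 + f = f"
    by (transfer; simp add: algebra_simps)+
  show "- f + f = 0"
    unfolding uminus_SL_inf_def by transfer simp
  show "f - g = f + - g"
    by (rule minus_SL_inf_def)
  show "r *\<^sub>R (f + g) = r *\<^sub>R f + r *\<^sub>R g" "(r + s) *\<^sub>R f = r *\<^sub>R f + s *\<^sub>R f"
    "r *\<^sub>R s *\<^sub>R f = (r * s) *\<^sub>R f" "1 *\<^sub>R f = f"
    by (transfer; simp add: algebra_simps)+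
  show "sgn f = inverse (norm f) *\<^sub>R f" "dist f g = norm (f - g)"
    by (simp_all add: sgn_SL_inf_def dist_SL_inf_def)
  show "(uniformity :: (SL_inf \<times> SL_inf) filter) = (INF e\<in>{0<..}. principal {(f, g). dist f g < e})"
    by (rule uniformity_SL_inf_def)
  show "open U \<longleftrightarrow> (\<forall>f\<in>U. \<forall>\<^sub>F (f', g) in uniformity. f' = f \<longrightarrow> g \<in> U)" for U :: "SL_inf set"
    by (rule open_SL_inf_def)
  show "norm f = 0 \<longleftrightarrow> f = 0"
  proof transfer
    fix a :: "real set \<Rightarrow> real"
    assume a: "(\<forall>I. I \<notin> dyadic_intervals \<longrightarrow> a I = 0) \<and> SL_ennorm a < top"
    show "enn2real (SL_ennorm a) = 0 \<longleftrightarrow> a = (\<lambda>_. 0)"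
    proof
      assume "enn2real (SL_ennorm a) = 0"
      then have "SL_ennorm a = 0"
        using a by (auto simp: enn2real_eq_0_iff)
      then have "a I = 0" for I
        using a abs_coeff_le_SL_ennorm[of I a] by (cases "I \<in> dyadic_intervals") auto
      then show "a = (\<lambda>_. 0)" by auto
    qed (simp add: SL_ennorm_zero)
  qed
  show "norm (f + g) \<le> norm f + norm g"
  proof transfer
    fix a b :: "real set \<Rightarrow> real"
    assume a: "(\<forall>I. I \<notin> dyadic_intervals \<longrightarrow> a I = 0) \<and> SL_ennorm a < top"
      and b: "(\<forall>I. I \<notin> dyadic_intervals \<longrightarrow> b I = 0) \<and> SL_ennorm b < top"
    have "enn2real (SL_ennorm (\<lambda>I. a I + b I)) \<le> enn2real (SL_ennorm a + SL_ennorm b)"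
      using a b by (intro enn2real_mono SL_ennorm_add) simp
    then show "enn2real (SL_ennorm (\<lambda>I. a I + b I)) \<le> enn2real (SL_ennorm a) + enn2real (SL_ennorm b)"
      using a b by (simp add: enn2real_plus)
  qed
  show "norm (r *\<^sub>R f) = \<bar>r\<bar> * norm f"
    by transfer (simp add: SL_ennorm_scale enn2real_mult)
qed

end

lift_definition haar_series :: "real set \<Rightarrow> SL_inf" is
  "\<lambda>J I. if I = J \<and> J \<in> dyadic_intervals then 1 else 0"
proof (intro conjI allI impI)
  fix J :: "real set"
  define e :: "real set \<Rightarrow> real" where "e = (\<lambda>I. if I = J \<and> J \<in> dyadic_intervals then 1 else 0)"
  have "square_function e x \<le> ennreal 1" for x
  proof (subst square_function_le_iff; clarsimp)
    fix F :: "real set set" assume "finite F"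
    have "(\<Sum>I\<in>F. (e I * haar I x)\<^sup>2) \<le> (\<Sum>I\<in>F. if I = J then 1 else 0)"
      by (rule sum_mono) (simp add: e_def power_mult_distrib haar_square indicator_def)
    also have "\<dots> \<le> 1"
      using \<open>finite F\<close> by simp
    finally show "L2_set (\<lambda>I. e I * haar I x) F \<le> 1"
      by (simp add: L2_set_def)
  qed
  then have "SL_ennorm e \<le> ennreal 1"
    unfolding SL_ennorm_le_iff by simp
  then show "SL_ennorm (\<lambda>I. if I = J \<and> J \<in> dyadic_intervals then 1 else 0) < top"
    unfolding e_def by (rule le_less_trans) simp
qed auto

definition pairing :: "SL_inf \<Rightarrow> real set \<Rightarrow> real" where
  "pairing f J = coeff f J * measure lebesgue J"

end

theory Submission
  imports Defs
begin

text \<open>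
  Index the dyadic intervals by finite binary words, the word spelling out the successive choices of
  left and right half. A partial sum of the square function is constant on the intervals of one level,
  so \<open>norm f \<le> c\<close> means that for every word \<open>w\<close> the squares of the coefficients at the prefixes
  of \<open>w\<close> sum to at most \<open>c\<^sup>2\<close> (\<open>norm_le_iff_chain_square\<close>). From there on the argument is
  about the binary tree.

  \<^bold>\<open>Block bases.\<close> Give each word \<open>w\<close> a level \<open>\<mu> w\<close>, increasing along an enumeration of the
  words in which prefixes come first. The block of \<open>w\<close> consists of all words \<open>K\<close> of length
  \<open>\<mu> w\<close> whose letter at position \<open>\<mu> (take j w)\<close> is the \<open>j\<close>-th letter of \<open>w\<close>, for all
  \<open>j < length w\<close>. Blocks are nested as the words are, so spreading each coefficient over its block,
  with arbitrary signs, is an operator \<open>R\<close> of norm at most 1 (\<open>block_embedding\<close>). The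
  letters of a random member of the block of \<open>w\<close> are independent, so for a prefix \<open>v\<close> of \<open>w\<close> its
  prefix of length \<open>\<mu> v\<close> is uniformly distributed in the block of \<open>v\<close>
  (\<open>mean_words_take\<close>). Hence averaging over blocks, again with arbitrary signs, is an operator
  \<open>Q\<close> of norm at most 1 (\<open>block_projection\<close>). Both bounds hold for every increasing choice of
  levels and every choice of signs, so these can be adapted to \<open>T\<close>.

  \<^bold>\<open>Choice of the blocks.\<close> Enumerate the words and treat them one at a time. The aim is
  that \<open>Q \<circ> T \<circ> R\<close> is nearly diagonal with diagonal entries at least \<open>\<delta>\<close>.
  \<^item> For the diagonal entry, random signs make the expectation of the quadratic form
    that defines it equal to an average of numbers \<open>\<bar>\<langle>T h\<^sub>K, h\<^sub>K\<rangle>\<bar> / \<bar>K\<bar> \<ge> \<delta>\<close>,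
    so some choice of signs does at least as well (\<open>exists_signs_large_block_mean\<close>).
  \<^item> For the effect of earlier blocks on the current coefficient, the averages of
    \<open>\<bar>T b\<bar>\<close> over the possible blocks are square summable over the levels, hence
    small at all sufficiently high levels (\<open>mean_abs_haar_coeff_tendsto_0\<close>).
  \<^item> For the effect of later blocks, small matrix entries do not suffice: the Haar functions do
    not span a dense subspace, and a functional may vanish on all of them without being zero. But
    every bounded functional is uniformly small on all series
    supported on a suitable infinite set of levels. Otherwise \<open>n\<close> disjoint infinite sets of
    levels would carry unit vectors on which the functional exceeds \<open>\<epsilon>\<close>; their sum has norm at
    most \<open>sqrt n\<close>, while the functional exceeds \<open>n * \<epsilon>\<close>
    (\<open>functional_small_on_sparse_levels\<close>). After each step only such a set of levels is
    kept for the rest of the construction.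

  Dividing by the diagonal, which costs the factor \<open>1 / \<delta>\<close>, yields an operator
  whose distance from the identity is less than 1. The space is complete, so the operator is invertible, with
  inverse of norm at most \<open>1 + \<eta>\<close>.
\<close>

section \<open>Dyadic intervals as binary words\<close>

definition dyadic_index :: "bool list \<Rightarrow> nat" where
  "dyadic_index w = foldl (\<lambda>k b. 2 * k + of_bool b) 0 w"

lemma dyadic_index_Nil [simp]: "dyadic_index [] = 0"
  and dyadic_index_snoc [simp]: "dyadic_index (w @ [b]) = 2 * dyadic_index w + of_bool b"
  by (simp_all add: dyadic_index_def)

lemma dyadic_index_less: "dyadic_index w < 2 ^ length w"
  by (induction w rule: rev_induct) (auto simp: of_bool_def)

lemma dyadic_index_inj:
  "length w = length v \<Longrightarrow> dyadic_index w = dyadic_index v \<Longrightarrow> w = v"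
proof (induction w arbitrary: v rule: rev_induct)
  case (snoc b w)
  then obtain v' c where v: "v = v' @ [c]"
    by (metis length_0_conv rev_exhaust snoc_eq_iff_butlast)
  have "2 * dyadic_index w + of_bool b = 2 * dyadic_index v' + of_bool c"
    using snoc.prems v by simp
  then have "dyadic_index w = dyadic_index v' \<and> b = c"
    by (cases b; cases c; simp; presburger)
  then show ?case
    using snoc v by simp
qed simp

lemma dyadic_index_surj: "k < 2 ^ n \<Longrightarrow> \<exists>w. length w = n \<and> dyadic_index w = k"
proof (induction n arbitrary: k)
  case (Suc n)
  then have "k div 2 < 2 ^ n"
    by (simp add: less_mult_imp_div_less mult.commute)
  then obtain w where "length w = n" "dyadic_index w = k div 2"
    using Suc.IH by blast
  then show ?case
    by (intro exI[of _ "w @ [odd k]"]) (simp add: mult_div_mod_eq[symmetric] flip: mod_2_eq_odd)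
qed simp

definition word_interval :: "bool list \<Rightarrow> real set" where
  "word_interval w =
    {real (dyadic_index w) / 2 ^ length w ..< real (dyadic_index w + 1) / 2 ^ length w}"

text \<open>In terms of the integer part, the word of given length whose interval contains a point is visibly
  unique, and dropping the last letter halves the index.\<close>
lemma mem_word_interval_iff:
  "x \<in> word_interval w \<longleftrightarrow> \<lfloor>x * 2 ^ length w\<rfloor> = int (dyadic_index w)"
  by (auto simp: word_interval_def floor_eq_iff field_simps)

lemma word_interval_dyadic [simp]: "word_interval w \<in> dyadic_intervals"
  unfolding dyadic_intervals_def word_interval_def using dyadic_index_less[of w] by blast

lemma dyadic_intervals_eq_range: "dyadic_intervals = range word_interval"
proof
  show "dyadic_intervals \<subseteq> range word_interval"
  proof
    fix I assume "I \<in> dyadic_intervals"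
    then obtain n k where "I = {real k / 2 ^ n ..< real (k + 1) / 2 ^ n}" "k < 2 ^ n"
      unfolding dyadic_intervals_def by blast
    with dyadic_index_surj[of k n] show "I \<in> range word_interval"
      by (auto simp: word_interval_def image_iff)
  qed
qed auto

lemma measure_word_interval: "measure lebesgue (word_interval w) = 1 / 2 ^ length w"
  by (simp add: word_interval_def diff_divide_distrib[symmetric] divide_right_mono)

lemma word_interval_nonempty: "\<exists>x. x \<in> word_interval w"
  by (rule exI[of _ "real (dyadic_index w) / 2 ^ length w"]) (simp add: mem_word_interval_iff)

lemma word_interval_unique:
  assumes "x \<in> word_interval w" "x \<in> word_interval v" "length w = length v"
  shows "w = v"
  using assms by (intro dyadic_index_inj) (auto simp: mem_word_interval_iff)

lemma inj_word_interval: "inj word_interval"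
proof (rule injI)
  fix w v assume eq: "word_interval w = word_interval v"
  then have "length w = length v"
    using measure_word_interval[of w] measure_word_interval[of v] by simp
  with eq word_interval_nonempty[of w] show "w = v"
    using word_interval_unique by blast
qed

lemma word_interval_butlast: "x \<in> word_interval (w @ [b]) \<Longrightarrow> x \<in> word_interval w"
  by (cases b) (auto simp: mem_word_interval_iff floor_eq_iff)

lemma word_interval_take: "x \<in> word_interval w \<Longrightarrow> x \<in> word_interval (take j w)"
proof (induction w rule: rev_induct)
  case (snoc b w)
  then show ?case
    using word_interval_butlast[of x w b] by (cases "j \<le> length w") auto
qed simp

lemma ex_word_interval:
  assumes "0 \<le> x" "x < 1"
  shows "\<exists>w. length w = n \<and> x \<in> word_interval w"
proof -
  have "x * 2 ^ n < 2 ^ n" using assms by simp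
  then have "\<lfloor>x * 2 ^ n\<rfloor> < 2 ^ n"
    by (simp add: floor_less_iff)
  moreover have "0 \<le> \<lfloor>x * 2 ^ n\<rfloor>"
    using assms by simp
  ultimately have "nat \<lfloor>x * 2 ^ n\<rfloor> < 2 ^ n"
    by (simp add: nat_less_iff)
  from dyadic_index_surj[OF this] show ?thesis
    using \<open>0 \<le> \<lfloor>x * 2 ^ n\<rfloor>\<close> by (auto simp: mem_word_interval_iff)
qed

lemma word_interval_subset_unit: "word_interval w \<subseteq> {0..<1}"
proof -
  obtain a b where "word_interval w = {a..<b}" "0 \<le> a" "b \<le> 1"
    using dyadic_intervalsE[OF word_interval_dyadic[of w]] by metis
  then show ?thesis by auto
qed

section \<open>The norm\<close>

definition haar_coeff :: "SL_inf \<Rightarrow> bool list \<Rightarrow> real" where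
  "haar_coeff f w = coeff f (word_interval w)"

definition chain_square :: "(bool list \<Rightarrow> real) \<Rightarrow> bool list \<Rightarrow> real" where
  "chain_square a w = (\<Sum>j\<le>length w. (a (take j w))\<^sup>2)"

lemma haar_coeff_add [simp]: "haar_coeff (f + g) w = haar_coeff f w + haar_coeff g w"
  and haar_coeff_scaleR [simp]: "haar_coeff (r *\<^sub>R f) w = r * haar_coeff f w"
  and haar_coeff_zero [simp]: "haar_coeff 0 w = 0"
  unfolding haar_coeff_def by (transfer, simp)+

lemma haar_coeff_minus [simp]: "haar_coeff (- f) w = - haar_coeff f w"
  using haar_coeff_scaleR[of "-1" f w] by (simp del: haar_coeff_scaleR)

lemma haar_coeff_diff [simp]: "haar_coeff (f - g) w = haar_coeff f w - haar_coeff g w"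
  using haar_coeff_add[of f "- g" w] by simp

lemma haar_coeff_sum: "haar_coeff (\<Sum>i\<in>A. f i) w = (\<Sum>i\<in>A. haar_coeff (f i) w)"
  by (induction A rule: infinite_finite_induct) auto

lemma haar_coeff_haar_series [simp]:
  "haar_coeff (haar_series (word_interval v)) w = (if w = v then 1 else 0)"
  unfolding haar_coeff_def using inj_word_interval by transfer (auto dest: injD)

lemma SL_inf_eqI:
  assumes "\<And>w. haar_coeff f w = haar_coeff g w"
  shows "f = g"
proof -
  have "coeff f I = coeff g I" for I
  proof (cases "I \<in> dyadic_intervals")
    case True
    then show ?thesis
      using assms by (auto simp: dyadic_intervals_eq_range haar_coeff_def)
  next
    case False
    then show ?thesis
      using coeff[of f] coeff[of g] by auto
  qed
  then show ?thesis
    by (simp add: coeff_inject[symmetric] fun_eq_iff)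
qed

text \<open>For a finite set of intervals the sum of squares at a point depends only on the intervals that contain the
  point, which belong to the prefixes of one word. Conversely an almost everywhere bound holds somewhere in
  every dyadic interval, because these have positive measure; so no word is lost in the essential
  supremum.\<close>
lemma SL_ennorm_le_iff_chain_square:
  assumes "0 \<le> c"
  shows "SL_ennorm a \<le> ennreal c \<longleftrightarrow> (\<forall>w. chain_square (\<lambda>v. a (word_interval v)) w \<le> c\<^sup>2)"
proof (intro iffI allI)
  fix w assume "SL_ennorm a \<le> ennreal c"
  then have ae: "AE x in lebesgue_on {0..<1}. square_function a x \<le> ennreal c"
    by (simp add: SL_ennorm_le_iff)
  have "\<exists>x\<in>word_interval w. square_function a x \<le> ennreal c"
  proof (rule ccontr)
    assume "\<not> ?thesis"
    then have "AE x in lebesgue. x \<notin> word_interval w"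
      using ae word_interval_subset_unit[of w]
      by (auto simp: AE_restrict_space_iff elim!: eventually_mono)
    moreover have "word_interval w \<in> sets lebesgue"
      by (simp add: word_interval_def)
    ultimately have "emeasure lebesgue (word_interval w) = 0"
      using AE_iff_measurable[of "word_interval w" lebesgue "\<lambda>x. x \<notin> word_interval w"] by simp
    then show False
      using measure_word_interval[of w] by (simp add: measure_def)
  qed
  then obtain x where x: "x \<in> word_interval w" "square_function a x \<le> ennreal c"
    by blast
  define F where "F = (\<lambda>j. word_interval (take j w)) ` {..length w}"
  have inj: "inj_on (\<lambda>j. word_interval (take j w)) {..length w}"
  proof (rule inj_onI)
    fix i j assume "i \<in> {..length w}" "j \<in> {..length w}"
      "word_interval (take i w) = word_interval (take j w)"
    then show "i = j"
      using injD[OF inj_word_interval, of "take i w" "take j w"]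
      by (auto dest: arg_cong[where f = length])
  qed
  have "finite F" "F \<subseteq> dyadic_intervals"
    by (auto simp: F_def)
  then have "L2_set (\<lambda>I. a I * haar I x) F \<le> c"
    using x(2) unfolding square_function_le_iff[OF assms] by blast
  then have "(L2_set (\<lambda>I. a I * haar I x) F)\<^sup>2 \<le> c\<^sup>2"
    by (intro power_mono) (simp_all add: L2_set_nonneg)
  also have "(L2_set (\<lambda>I. a I * haar I x) F)\<^sup>2 = (\<Sum>I\<in>F. (a I)\<^sup>2 * indicator I x)"
    by (simp add: L2_set_def sum_nonneg power_mult_distrib haar_square)
  also have "\<dots> = chain_square (\<lambda>v. a (word_interval v)) w"
    unfolding F_def sum.reindex[OF inj] chain_square_def
    using word_interval_take[OF x(1)] by (intro sum.cong) auto
  finally show "chain_square (\<lambda>v. a (word_interval v)) w \<le> c\<^sup>2" .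
next
  assume *: "\<forall>w. chain_square (\<lambda>v. a (word_interval v)) w \<le> c\<^sup>2"
  have "square_function a x \<le> ennreal c" if x: "0 \<le> x" "x < 1" for x
    unfolding square_function_le_iff[OF assms]
  proof (intro allI impI; elim conjE)
    fix F :: "real set set" assume F: "finite F" "F \<subseteq> dyadic_intervals"
    then obtain G where G: "finite G" "F = word_interval ` G"
      by (metis dyadic_intervals_eq_range finite_subset_image)
    define n where "n = Max (insert 0 (length ` G))"
    have n: "length v \<le> n" if "v \<in> G" for v
      unfolding n_def using G(1) that by (intro Max_ge) auto
    obtain w where w: "length w = n" "x \<in> word_interval w"
      using ex_word_interval[OF x] by blast
    have "(\<Sum>I\<in>F. (a I * haar I x)\<^sup>2) = (\<Sum>v\<in>G. (a (word_interval v))\<^sup>2 * indicator (word_interval v) x)"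
      unfolding G(2) using inj_word_interval
      by (subst sum.reindex) (auto simp: inj_on_def inj_def power_mult_distrib haar_square)
    also have "\<dots> = (\<Sum>v\<in>{v\<in>G. x \<in> word_interval v}. (a (word_interval v))\<^sup>2)"
      using G(1) by (intro sum.mono_neutral_cong_right) auto
    also have "\<dots> \<le> chain_square (\<lambda>v. a (word_interval v)) w"
      unfolding chain_square_def
    proof (rule sum_le_included[where i = "\<lambda>j. take j w"])
      show "\<forall>v\<in>{v \<in> G. x \<in> word_interval v}. \<exists>j\<in>{..length w}. take j w = v \<and>
          (a (word_interval v))\<^sup>2 \<le> (a (word_interval (take j w)))\<^sup>2"
      proof
        fix v assume v: "v \<in> {v \<in> G. x \<in> word_interval v}"
        then have "take (length v) w = v"
          using word_interval_take[OF w(2), of "length v"] w(1) n[of v]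
          by (intro word_interval_unique[of x]) auto
        with v n[of v] w(1) show "\<exists>j\<in>{..length w}. take j w = v \<and>
          (a (word_interval v))\<^sup>2 \<le> (a (word_interval (take j w)))\<^sup>2"
          by (intro bexI[of _ "length v"]) auto
      qed
    qed (use G(1) in auto)
    also have "\<dots> \<le> c\<^sup>2" using * by blast
    finally show "L2_set (\<lambda>I. a I * haar I x) F \<le> c"
      unfolding L2_set_def using assms by (simp add: real_le_lsqrt)
  qed
  then show "SL_ennorm a \<le> ennreal c"
    unfolding SL_ennorm_le_iff by (intro AE_I2) (auto simp: space_restrict_space)
qed

lemma norm_le_iff_chain_square:
  assumes "0 \<le> c"
  shows "norm f \<le> c \<longleftrightarrow> (\<forall>w. chain_square (haar_coeff f) w \<le> c\<^sup>2)"
proof -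
  have fin: "SL_ennorm (coeff f) < top"
    using coeff[of f] by simp
  have "norm f \<le> c \<longleftrightarrow> SL_ennorm (coeff f) \<le> ennreal c"
    unfolding norm_SL_inf.rep_eq using fin assms
    by (metis ennreal_enn2real ennreal_le_iff)
  then show ?thesis
    unfolding SL_ennorm_le_iff_chain_square[OF assms] haar_coeff_def[abs_def] .
qed

lemma chain_square_le_norm: "chain_square (haar_coeff f) w \<le> (norm f)\<^sup>2"
  using norm_le_iff_chain_square[of "norm f" f] by simp

lemma haar_coeff_le_norm: "\<bar>haar_coeff f w\<bar> \<le> norm f"
proof -
  have "(haar_coeff f (take (length w) w))\<^sup>2 \<le> chain_square (haar_coeff f) w"
    unfolding chain_square_def by (rule member_le_sum) auto
  then have "(haar_coeff f w)\<^sup>2 \<le> (norm f)\<^sup>2"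
    using chain_square_le_norm[of f w] by simp
  then show ?thesis
    by (simp add: abs_le_square_iff[symmetric])
qed

text \<open>Meaningful only for coefficient families with bounded chain sums, see
  \<open>haar_coeff_of_haar_coeffs\<close>.\<close>
definition of_haar_coeffs :: "(bool list \<Rightarrow> real) \<Rightarrow> SL_inf" where
  "of_haar_coeffs a = (SOME f. haar_coeff f = a)"

lemma haar_coeff_of_haar_coeffs:
  assumes "0 \<le> c" and "\<And>w. chain_square a w \<le> c\<^sup>2"
  shows "haar_coeff (of_haar_coeffs a) = a"
proof -
  define b where "b I = (if I \<in> dyadic_intervals then a (inv word_interval I) else 0)" for I
  have b: "b (word_interval w) = a w" for w
    by (simp add: b_def inv_f_f[OF inj_word_interval])
  have "SL_ennorm b \<le> ennreal c"
    unfolding SL_ennorm_le_iff_chain_square[OF assms(1)] b using assms(2) by simp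
  then have "SL_ennorm b < top"
    by (rule le_less_trans) simp
  then have "coeff (Abs_SL_inf b) = b"
    by (intro Abs_SL_inf_inverse) (simp add: b_def)
  then have "haar_coeff (Abs_SL_inf b) = a"
    by (simp add: haar_coeff_def[abs_def] b)
  then show ?thesis
    unfolding of_haar_coeffs_def by (rule someI)
qed

lemma chain_square_mono:
  assumes "\<And>j. j \<le> length w \<Longrightarrow> \<bar>a (take j w)\<bar> \<le> \<bar>b (take j w)\<bar>"
  shows "chain_square a w \<le> chain_square b w"
  unfolding chain_square_def using assms
  by (intro sum_mono) (auto simp: abs_le_square_iff[symmetric])

text \<open>Chain sums are finite, so they pass to coefficientwise limits, and a coefficientwise limit of a Cauchy
  sequence is a limit in norm.\<close>
lemma complete_SL_inf: "complete (UNIV :: SL_inf set)"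
  unfolding complete_def
proof (intro allI impI; elim conjE)
  fix X :: "nat \<Rightarrow> SL_inf" assume X: "Cauchy X"
  have "Cauchy (\<lambda>n. haar_coeff (X n) w)" for w
  proof (rule metric_CauchyI)
    fix e :: real assume "e > 0"
    then obtain M where M: "\<forall>m\<ge>M. \<forall>n\<ge>M. dist (X m) (X n) < e"
      using metric_CauchyD[OF X] by blast
    have "dist (haar_coeff (X m) w) (haar_coeff (X n) w) \<le> dist (X m) (X n)" for m n
      using haar_coeff_le_norm[of "X m - X n" w] by (simp add: dist_norm)
    with M show "\<exists>M. \<forall>m\<ge>M. \<forall>n\<ge>M. dist (haar_coeff (X m) w) (haar_coeff (X n) w) < e"
      by (meson order.strict_trans1)
  qed
  then have "\<exists>l. (\<lambda>n. haar_coeff (X n) w) \<longlonglongrightarrow> l" for w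
    by (simp add: Cauchy_convergent_iff convergent_def)
  then obtain a where a: "\<And>w. (\<lambda>n. haar_coeff (X n) w) \<longlonglongrightarrow> a w"
    by metis
  have tail: "\<exists>M. \<forall>n\<ge>M. \<forall>w. chain_square (\<lambda>v. a v - haar_coeff (X n) v) w \<le> e\<^sup>2" if "e > 0" for e
  proof -
    obtain M where M: "\<forall>m\<ge>M. \<forall>n\<ge>M. norm (X m - X n) < e"
      using metric_CauchyD[OF X \<open>e > 0\<close>] by (auto simp: dist_norm)
    have "chain_square (\<lambda>v. a v - haar_coeff (X n) v) w \<le> e\<^sup>2" if n: "n \<ge> M" for n w
    proof (rule LIMSEQ_le_const2)
      show "(\<lambda>m. chain_square (haar_coeff (X m - X n)) w)
          \<longlonglongrightarrow> chain_square (\<lambda>v. a v - haar_coeff (X n) v) w"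
        unfolding chain_square_def haar_coeff_diff by (intro tendsto_intros a)
      have "chain_square (haar_coeff (X m - X n)) w \<le> e\<^sup>2" if "m \<ge> M" for m
        using norm_le_iff_chain_square[of e "X m - X n"] M n that \<open>e > 0\<close> by (simp add: less_imp_le)
      then show "\<exists>N. \<forall>m\<ge>N. chain_square (haar_coeff (X m - X n)) w \<le> e\<^sup>2"
        by blast
    qed
    then show ?thesis by blast
  qed
  obtain M where M: "\<And>w. chain_square (\<lambda>v. a v - haar_coeff (X M) v) w \<le> 1\<^sup>2"
    using tail[of 1] by auto
  define l where "l = X M + of_haar_coeffs (\<lambda>v. a v - haar_coeff (X M) v)"
  have l: "haar_coeff l w = a w" for w
    using haar_coeff_of_haar_coeffs[OF _ M] by (simp add: l_def)
  have "X \<longlonglongrightarrow> l"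
  proof (rule metric_LIMSEQ_I)
    fix e :: real assume "e > 0"
    then obtain M where M: "\<forall>n\<ge>M. \<forall>w. chain_square (\<lambda>v. a v - haar_coeff (X n) v) w \<le> (e/2)\<^sup>2"
      using tail[of "e/2"] by auto
    have "norm (l - X n) \<le> e/2" if "n \<ge> M" for n
      using M that \<open>e > 0\<close> norm_le_iff_chain_square[of "e/2" "l - X n"]
      by (simp add: l haar_coeff_diff[abs_def])
    with \<open>e > 0\<close> show "\<exists>M. \<forall>n\<ge>M. dist (X n) l < e"
      by (intro exI[of _ M]) (force simp: dist_norm norm_minus_commute)
  qed
  then show "\<exists>l\<in>UNIV. X \<longlonglongrightarrow> l" by blast
qed

section \<open>Averages over words with prescribed letters\<close>

text \<open>As an event, \<open>words p m\<close> says that the letter at each position \<open>i < m\<close> of an infinite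
  word lies in \<open>p i\<close>; its members are the dyadic intervals of level \<open>m\<close> inside that event.\<close>
definition words :: "(nat \<Rightarrow> bool set) \<Rightarrow> nat \<Rightarrow> bool list set" where
  "words p m = {K. length K = m \<and> (\<forall>i<m. K ! i \<in> p i)}"

definition mean :: "'a set \<Rightarrow> ('a \<Rightarrow> real) \<Rightarrow> real" where
  "mean B g = (\<Sum>K\<in>B. g K) / card B"

lemma words_0 [simp]: "words p 0 = {[]}"
  by (auto simp: words_def)

lemma words_Suc: "words p (Suc m) = (\<lambda>(K, b). K @ [b]) ` (words p m \<times> p m)"
proof
  show "words p (Suc m) \<subseteq> (\<lambda>(K, b). K @ [b]) ` (words p m \<times> p m)"
  proof
    fix K assume K: "K \<in> words p (Suc m)"
    then obtain L b where L: "K = L @ [b]"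
      by (cases K rule: rev_cases) (auto simp: words_def)
    with K have "L \<in> words p m" "b \<in> p m"
      by (auto simp: words_def nth_append less_Suc_eq all_conj_distrib)
    with L show "K \<in> (\<lambda>(K, b). K @ [b]) ` (words p m \<times> p m)"
      by force
  qed
qed (auto simp: words_def nth_append less_Suc_eq)

lemma inj_on_append_letter: "inj_on (\<lambda>(K, b). K @ [b]) X"
  by (auto simp: inj_on_def)

lemma finite_words [simp]: "finite (words p m)"
  by (induction m) (auto simp: words_Suc)

lemma words_nonempty: "(\<And>i. p i \<noteq> {}) \<Longrightarrow> words p m \<noteq> {}"
  by (induction m) (auto simp: words_Suc)

lemma words_cong: "(\<And>i. i < m \<Longrightarrow> p i = q i) \<Longrightarrow> words p m = words q m"
  by (auto simp: words_def)

text \<open>The letters of a uniformly chosen member of \<open>words p m\<close> are independent, so its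
  prefix of length \<open>i\<close> is uniformly distributed in \<open>words p i\<close>. One more letter multiplies the
  numerator and the denominator of the mean by the number of admissible letters.\<close>
lemma mean_words_take:
  assumes p: "\<And>i. p i \<noteq> {}" and "i \<le> m"
  shows "mean (words p m) (\<lambda>K. g (take i K)) = mean (words p i) g"
  using \<open>i \<le> m\<close>
proof (induction m rule: dec_induct)
  case base
  show ?case
    unfolding mean_def by (intro arg_cong2[where f = "(/)"] sum.cong) (auto simp: words_def)
next
  case (step m)
  have card: "card (words p (Suc m)) = card (words p m) * card (p m)"
    unfolding words_Suc card_image[OF inj_on_append_letter] by (rule card_cartesian_product)
  have "(\<Sum>K\<in>words p (Suc m). g (take i K)) = (\<Sum>(K, b)\<in>words p m \<times> p m. g (take i (K @ [b])))"
    unfolding words_Suc sum.reindex[OF inj_on_append_letter] by (simp add: case_prod_beta)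
  also have "\<dots> = (\<Sum>(K, b)\<in>words p m \<times> p m. g (take i K))"
    using step.hyps by (intro sum.cong) (auto simp: words_def)
  also have "\<dots> = card (p m) * (\<Sum>K\<in>words p m. g (take i K))"
    by (simp add: sum.cartesian_product[symmetric] sum_distrib_left)
  finally have "mean (words p (Suc m)) (\<lambda>K. g (take i K)) = mean (words p m) (\<lambda>K. g (take i K))"
    using p[of m] by (simp add: mean_def card)
  with step.IH show ?case by simp
qed

lemma mean_mono: "(\<And>K. K \<in> B \<Longrightarrow> g K \<le> h K) \<Longrightarrow> mean B g \<le> mean B h"
  unfolding mean_def by (intro divide_right_mono sum_mono) auto

lemma mean_sum: "mean B (\<lambda>K. \<Sum>j\<in>J. g j K) = (\<Sum>j\<in>J. mean B (g j))"
  unfolding mean_def by (subst sum.swap) (simp add: sum_divide_distrib)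

lemma mean_const_le: "0 \<le> c \<Longrightarrow> mean B (\<lambda>_. c) \<le> c"
  by (cases "card B = 0") (simp_all add: mean_def)

lemma mean_nonneg: "(\<And>K. K \<in> B \<Longrightarrow> 0 \<le> g K) \<Longrightarrow> 0 \<le> mean B g"
  unfolding mean_def by (intro divide_nonneg_nonneg sum_nonneg) auto

lemma mean_square_le: "(mean B g)\<^sup>2 \<le> mean B (\<lambda>K. (g K)\<^sup>2)"
proof (cases "card B = 0")
  case False
  then show ?thesis
    using sum_squared_le_sum_of_squares[of g B]
    by (simp add: mean_def power_divide divide_simps power2_eq_square mult.assoc)
qed (simp add: mean_def)

text \<open>Uniform distribution moves the means on all the levels to one set of long words, and there the sum of
  squares is part of a chain sum. This carries the square function estimate both for averaging over
  blocks and for the decay of means along the levels.\<close>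
lemma sum_mean_square_le:
  assumes p: "\<And>i. p i \<noteq> {}" and J: "finite J" "\<And>j. j \<in> J \<Longrightarrow> l j \<le> m" "inj_on l J"
  shows "(\<Sum>j\<in>J. mean (words p (l j)) (\<lambda>K. (haar_coeff f K)\<^sup>2)) \<le> (norm f)\<^sup>2"
proof -
  have "(\<Sum>j\<in>J. mean (words p (l j)) (\<lambda>K. (haar_coeff f K)\<^sup>2))
      = mean (words p m) (\<lambda>K. \<Sum>j\<in>J. (haar_coeff f (take (l j) K))\<^sup>2)"
    unfolding mean_sum using J(2) by (intro sum.cong) (simp_all add: mean_words_take[OF p, where g = "\<lambda>K. (haar_coeff f K)\<^sup>2"])
  also have "\<dots> \<le> mean (words p m) (\<lambda>K. (norm f)\<^sup>2)"
  proof (rule mean_mono)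
    fix K assume K: "K \<in> words p m"
    have "(\<Sum>j\<in>J. (haar_coeff f (take (l j) K))\<^sup>2) = (\<Sum>i\<in>l ` J. (haar_coeff f (take i K))\<^sup>2)"
      by (simp add: sum.reindex[OF J(3)])
    also have "\<dots> \<le> chain_square (haar_coeff f) K"
      unfolding chain_square_def using K J(2) by (intro sum_mono2) (auto simp: words_def)
    also have "\<dots> \<le> (norm f)\<^sup>2"
      by (rule chain_square_le_norm)
    finally show "(\<Sum>j\<in>J. (haar_coeff f (take (l j) K))\<^sup>2) \<le> (norm f)\<^sup>2" .
  qed
  also have "\<dots> \<le> (norm f)\<^sup>2"
    by (rule mean_const_le) simp
  finally show ?thesis .
qed

lemma mean_abs_haar_coeff_tendsto_0:
  assumes p: "\<And>i. p i \<noteq> {}"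
  shows "(\<lambda>m. mean (words p m) (\<lambda>K. \<bar>haar_coeff f K\<bar>)) \<longlonglongrightarrow> 0"
proof -
  define s where "s m = mean (words p m) (\<lambda>K. (haar_coeff f K)\<^sup>2)" for m
  have s0: "0 \<le> s m" for m
    unfolding s_def by (rule mean_nonneg) simp
  have "summable s"
  proof (rule summableI_nonneg_bounded[OF s0])
    show "(\<Sum>i<n. s i) \<le> (norm f)\<^sup>2" for n
      unfolding s_def by (rule sum_mean_square_le[OF p, where m = n and l = id, simplified]) auto
  qed
  then have "(\<lambda>m. sqrt (s m)) \<longlonglongrightarrow> 0"
    using tendsto_real_sqrt[OF summable_LIMSEQ_zero] by fastforce
  then show ?thesis
  proof (rule tendsto_sandwich[OF _ _ tendsto_const, rotated 2])
    show "\<forall>\<^sub>F m in sequentially. 0 \<le> mean (words p m) (\<lambda>K. \<bar>haar_coeff f K\<bar>)"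
      by (intro always_eventually allI mean_nonneg) simp
    show "\<forall>\<^sub>F m in sequentially. mean (words p m) (\<lambda>K. \<bar>haar_coeff f K\<bar>) \<le> sqrt (s m)"
    proof (intro always_eventually allI real_le_rsqrt)
      show "(mean (words p m) (\<lambda>K. \<bar>haar_coeff f K\<bar>))\<^sup>2 \<le> s m" for m
        using mean_square_le[of "words p m" "\<lambda>K. \<bar>haar_coeff f K\<bar>"] by (simp add: s_def)
    qed
  qed
qed

section \<open>Functionals are small on sparse levels\<close>

definition supported_on :: "nat set \<Rightarrow> SL_inf \<Rightarrow> bool" where
  "supported_on N f \<longleftrightarrow> (\<forall>w. length w \<notin> N \<longrightarrow> haar_coeff f w = 0)"

text \<open>On disjoint sets of levels the square functions add up without cross terms.\<close>
lemma norm_sum_disjoint_levels: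
  assumes fin: "finite A"
    and supp: "\<And>k. k \<in> A \<Longrightarrow> supported_on (N k) (f k)"
    and disj: "disjoint_family_on N A"
    and norm: "\<And>k. k \<in> A \<Longrightarrow> norm (f k) \<le> 1"
  shows "norm (\<Sum>k\<in>A. f k) \<le> sqrt (card A)"
proof -
  have sq: "(\<Sum>k\<in>A. haar_coeff (f k) v)\<^sup>2 = (\<Sum>k\<in>A. (haar_coeff (f k) v)\<^sup>2)" for v
  proof (cases "\<exists>k\<in>A. length v \<in> N k")
    case True
    then obtain k where k: "k \<in> A" "length v \<in> N k" by blast
    have zero: "haar_coeff (f i) v = 0" if "i \<in> A - {k}" for i
      using k that supp[of i] disj by (auto simp: supported_on_def disjoint_family_on_def)
    show ?thesis
      using sum.mono_neutral_right[OF fin, of "{k}" "\<lambda>i. haar_coeff (f i) v"]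
        sum.mono_neutral_right[OF fin, of "{k}" "\<lambda>i. (haar_coeff (f i) v)\<^sup>2"] zero k(1)
      by simp
  next
    case False
    then show ?thesis
      using supp by (simp add: supported_on_def)
  qed
  have "chain_square (haar_coeff (\<Sum>k\<in>A. f k)) w \<le> (sqrt (card A))\<^sup>2" for w
  proof -
    have "chain_square (haar_coeff (\<Sum>k\<in>A. f k)) w = (\<Sum>k\<in>A. chain_square (haar_coeff (f k)) w)"
      unfolding chain_square_def haar_coeff_sum sq by (rule sum.swap)
    also have "\<dots> \<le> (\<Sum>k\<in>A. 1)"
    proof (rule sum_mono)
      show "chain_square (haar_coeff (f k)) w \<le> 1" if "k \<in> A" for k
        using norm_le_iff_chain_square[of 1 "f k"] norm[OF that] by simp
    qed
    finally show ?thesis by simp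
  qed
  then show ?thesis
    by (simp add: norm_le_iff_chain_square)
qed

text \<open>A functional \<open>f \<mapsto> \<langle>T f, h\<rangle>\<close> need not be weak-star continuous, so
  its values on Haar functions do not control it. If the claim fails for every infinite subset of \<open>N\<close>, split
  \<open>N\<close> into infinitely many infinite parts; normalized counterexamples from \<open>n\<close> of the parts have a
  sum of norm at most \<open>sqrt n\<close> but value at least \<open>n * \<epsilon>\<close>.\<close>
lemma functional_small_on_sparse_levels:
  fixes \<Lambda> :: "SL_inf \<Rightarrow> real"
  assumes "bounded_linear \<Lambda>" and "infinite N" and "0 < \<epsilon>"
  shows "\<exists>N'\<subseteq>N. infinite N' \<and> (\<forall>f. supported_on N' f \<longrightarrow> \<bar>\<Lambda> f\<bar> \<le> \<epsilon> * norm f)"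
proof (rule ccontr)
  interpret bounded_linear \<Lambda> by fact
  assume neg: "\<not> ?thesis"
  \<comment> \<open>the pairing function splits \<open>N\<close> into infinitely many disjoint infinite parts\<close>
  define M where "M k = (\<lambda>i. enumerate N (prod_encode (k, i))) ` UNIV" for k :: nat
  have inj: "enumerate N i = enumerate N j \<longleftrightarrow> i = j" for i j
    using strict_mono_enumerate[OF \<open>infinite N\<close>] by (rule strict_mono_eq)
  have "M k \<subseteq> N" for k
    using enumerate_in_set[OF \<open>infinite N\<close>] by (auto simp: M_def)
  moreover have "infinite (M k)" for k
    unfolding M_def by (rule range_inj_infinite) (auto intro!: injI simp: inj)
  ultimately have "\<exists>f. supported_on (M k) f \<and> \<epsilon> * norm f < \<bar>\<Lambda> f\<bar>" for k
    using neg by (meson not_le)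
  then obtain g where g: "\<And>k. supported_on (M k) (g k)" "\<And>k. \<epsilon> * norm (g k) < \<bar>\<Lambda> (g k)\<bar>"
    by metis
  define f where "f k = (sgn (\<Lambda> (g k)) / norm (g k)) *\<^sub>R g k" for k
  have "g k \<noteq> 0" for k
    using g(2)[of k] zero by auto
  then have gpos: "norm (g k) > 0" for k
    by simp
  have f: "supported_on (M k) (f k)" "norm (f k) \<le> 1" "\<epsilon> \<le> \<Lambda> (f k)" for k
  proof -
    show "supported_on (M k) (f k)"
      using g(1)[of k] by (simp add: supported_on_def f_def)
    show "norm (f k) \<le> 1"
      using gpos[of k] by (simp add: f_def abs_sgn_eq)
    have "\<Lambda> (f k) = \<bar>\<Lambda> (g k)\<bar> / norm (g k)"
      by (simp add: f_def scaleR sgn_mult_self_eq abs_sgn mult.commute)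
    with g(2)[of k] gpos[of k] show "\<epsilon> \<le> \<Lambda> (f k)"
      by (simp add: pos_le_divide_eq)
  qed
  have bound: "real n * \<epsilon> \<le> onorm \<Lambda> * sqrt n" for n :: nat
  proof -
    have "real n * \<epsilon> \<le> (\<Sum>k<n. \<Lambda> (f k))"
      using sum_mono[of "{..<n}" "\<lambda>_. \<epsilon>" "\<lambda>k. \<Lambda> (f k)"] f(3) by simp
    also have "\<dots> = \<Lambda> (\<Sum>k<n. f k)"
      by (simp add: sum)
    also have "\<dots> \<le> onorm \<Lambda> * norm (\<Sum>k<n. f k)"
      using onorm[OF assms(1), of "\<Sum>k<n. f k"] by simp
    also have "\<dots> \<le> onorm \<Lambda> * sqrt (card {..<n})"
    proof (intro mult_left_mono norm_sum_disjoint_levels[where N = M] f onorm_pos_le[OF assms(1)])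
      show "disjoint_family_on M {..<n}"
        by (auto simp: disjoint_family_on_def M_def inj)
    qed simp
    finally show ?thesis by simp
  qed
  obtain n :: nat where n: "real n > (onorm \<Lambda> / \<epsilon>)\<^sup>2"
    using reals_Archimedean2 by blast
  then have n0: "real n > 0"
    by (meson le_less_trans zero_le_power2)
  have "(sqrt n * \<epsilon>) * sqrt n = (sqrt n * sqrt n) * \<epsilon>"
    by (simp only: ac_simps)
  also have "\<dots> \<le> onorm \<Lambda> * sqrt n"
    using bound[of n] by simp
  finally have "sqrt n * \<epsilon> \<le> onorm \<Lambda>"
    by (rule mult_right_le_imp_le) (use n0 in simp)
  then have "sqrt n \<le> onorm \<Lambda> / \<epsilon>"
    using \<open>0 < \<epsilon>\<close> by (simp add: pos_le_divide_eq)
  then have "(sqrt n)\<^sup>2 \<le> (onorm \<Lambda> / \<epsilon>)\<^sup>2"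
    by (intro power_mono) simp_all
  with n show False by simp
qed

section \<open>Signs\<close>

text \<open>The right-hand side has the left-hand side as its mean over all choices of signs. Choosing the signs
  one by one, it is enough that each new sign make the cross terms that it multiplies nonnegative.\<close>
lemma exists_signs_sum_ge_diagonal:
  fixes c :: "'a \<Rightarrow> 'a \<Rightarrow> real"
  assumes "finite B"
  shows "\<exists>\<tau>. (\<forall>K. \<bar>\<tau> K\<bar> = 1) \<and> (\<Sum>K\<in>B. c K K) \<le> (\<Sum>K\<in>B. \<Sum>L\<in>B. \<tau> K * \<tau> L * c K L)"
  using assms
proof induction
  case empty
  show ?case by (rule exI[of _ "\<lambda>_. 1"]) simp
next
  case (insert x B)
  then obtain \<tau> where \<tau>: "\<And>K. \<bar>\<tau> K\<bar> = 1"
    "(\<Sum>K\<in>B. c K K) \<le> (\<Sum>K\<in>B. \<Sum>L\<in>B. \<tau> K * \<tau> L * c K L)" by blast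
  \<comment> \<open>the cross terms of \<open>x\<close> with \<open>B\<close>, up to the sign of \<open>x\<close>\<close>
  define X where "X = (\<Sum>K\<in>B. \<tau> K * (c x K + c K x))"
  define s :: real where "s = (if X < 0 then -1 else 1)"
  define \<tau>' where "\<tau>' = \<tau>(x := s)"
  have \<tau>'B: "\<tau>' K = \<tau> K" if "K \<in> B" for K
    using that insert.hyps by (auto simp: \<tau>'_def)
  have "(\<Sum>K\<in>insert x B. \<Sum>L\<in>insert x B. \<tau>' K * \<tau>' L * c K L)
     = s * s * c x x + s * X + (\<Sum>K\<in>B. \<Sum>L\<in>B. \<tau> K * \<tau> L * c K L)"
    using insert.hyps
    by (simp add: \<tau>'B sum.distrib X_def sum_distrib_left algebra_simps cong: sum.cong)
      (simp add: \<tau>'_def sum.distrib algebra_simps)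
  moreover have "s * s = 1" "0 \<le> s * X"
    by (auto simp: s_def)
  ultimately have "(\<Sum>K\<in>insert x B. c K K) \<le> (\<Sum>K\<in>insert x B. \<Sum>L\<in>insert x B. \<tau>' K * \<tau>' L * c K L)"
    using \<tau>(2) insert.hyps by simp
  moreover have "\<forall>K. \<bar>\<tau>' K\<bar> = 1"
    using \<tau>(1) by (auto simp: \<tau>'_def s_def)
  ultimately show ?case by blast
qed

section \<open>Operators close to the identity\<close>

text \<open>A solution of \<open>U x = y\<close> is a fixed point of the contraction \<open>x \<mapsto> x - U x + y\<close>.\<close>
lemma left_inverse_near_identity:
  fixes U :: "'a::real_normed_vector \<Rightarrow> 'a"
  assumes complete: "complete (UNIV :: 'a set)"
    and U: "bounded_linear U"
    and q: "0 \<le> q" "q < 1" and near: "\<And>x. norm (U x - x) \<le> q * norm x"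
  shows "\<exists>V. bounded_linear V \<and> V \<circ> U = id \<and> (\<forall>y. norm (V y) \<le> norm y / (1 - q))"
proof -
  interpret U: bounded_linear U by fact
  have "\<exists>!x\<in>UNIV. x - U x + y = x" for y
  proof (rule Banach_fix[OF complete _ q])
    fix u v
    have "u - U u + y - (v - U v + y) = - (U (u - v) - (u - v))"
      by (simp add: U.diff)
    then show "dist (u - U u + y) (v - U v + y) \<le> q * dist u v"
      using near[of "u - v"] by (metis dist_norm norm_minus_cancel)
  qed auto
  moreover have "x - U x + y = x \<longleftrightarrow> U x = y" for x y
    by (auto simp: algebra_simps)
  ultimately have ex1: "\<exists>!x. U x = y" for y
    by simp
  define V where "V y = (THE x. U x = y)" for y
  have UV: "U (V y) = y" for y
    unfolding V_def by (rule theI'[OF ex1])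
  have VU: "V (U x) = x" for x
    using ex1[of "U x"] UV by blast
  have bound: "norm (V y) \<le> norm y / (1 - q)" for y
  proof -
    have "norm (V y) \<le> norm (U (V y)) + norm (U (V y) - V y)"
      using norm_triangle_ineq4[of "U (V y)" "U (V y) - V y"] by simp
    also have "\<dots> \<le> norm y + q * norm (V y)"
      using near[of "V y"] by (simp add: UV)
    finally show ?thesis
      using q by (simp add: pos_le_divide_eq algebra_simps)
  qed
  have "bounded_linear V"
  proof (rule bounded_linear_intro)
    show "V (x + y) = V x + V y" for x y
      by (metis U.add UV VU)
    show "V (r *\<^sub>R x) = r *\<^sub>R V x" for r x
      by (metis U.scaleR UV VU)
    show "norm (V y) \<le> norm y * (1 / (1 - q))" for y
      using bound[of y] by simp
  qed
  with VU bound show ?thesis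
    by (intro exI[of _ V]) (auto simp: fun_eq_iff)
qed

section \<open>Blocks\<close>

text \<open>The heap numbering of the binary tree: the leading letter \<open>True\<close> makes words of different lengths
  comparable and puts prefixes first.\<close>
definition word_rank :: "bool list \<Rightarrow> nat" where
  "word_rank w = dyadic_index (True # w)"

lemma rank_Nil [simp]: "word_rank [] = 1"
  and rank_snoc [simp]: "word_rank (w @ [b]) = 2 * word_rank w + of_bool b"
  using dyadic_index_snoc[of "[]" True] dyadic_index_snoc[of "True # w" b]
  by (simp_all add: word_rank_def del: dyadic_index_snoc)

lemma rank_pos: "0 < word_rank w"
  by (induction w rule: rev_induct) auto

lemma rank_eq_iff [simp]: "word_rank w = word_rank v \<longleftrightarrow> w = v"
proof
  show "word_rank w = word_rank v \<Longrightarrow> w = v"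
  proof (induction w arbitrary: v rule: rev_induct)
    case Nil
    then show ?case
      using rank_pos[of "butlast v"] by (cases v rule: rev_cases) auto
  next
    case (snoc b w)
    then obtain v' c where v: "v = v' @ [c]"
      using rank_pos[of w] by (cases v rule: rev_cases) auto
    have "2 * word_rank w + of_bool b = 2 * word_rank v' + of_bool c"
      using snoc.prems v by simp
    then have "word_rank w = word_rank v' \<and> b = c"
      by (cases b; cases c; simp; presburger)
    with snoc.IH v show ?case by blast
  qed
qed simp

lemma finite_rank_less [simp]: "finite {v. word_rank v < n}"
  using finite_vimageI[of "{..<n}" word_rank] by (simp add: inj_def vimage_def)

lemma rank_take_less: "j < length w \<Longrightarrow> word_rank (take j w) < word_rank w"
proof (induction w rule: rev_induct)
  case (snoc b w)
  then show ?case
    using rank_pos[of w] by (cases "j = length w") auto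
qed simp

lemma rank_take_mono: "i < j \<Longrightarrow> j \<le> length w \<Longrightarrow> word_rank (take i w) < word_rank (take j w)"
  using rank_take_less[of i "take j w"] by (simp add: min_def)

text \<open>The letters that may stand at position \<open>i\<close> of a word in the block of \<open>w\<close>. Only the levels of the
  proper prefixes of \<open>w\<close> enter, so the constraint is known before the level of \<open>w\<close> itself is
  chosen.\<close>
definition letters :: "(bool list \<Rightarrow> nat) \<Rightarrow> bool list \<Rightarrow> nat \<Rightarrow> bool set" where
  "letters \<mu> w i = {b. \<forall>j<length w. i = \<mu> (take j w) \<longrightarrow> b = w ! j}"

definition block :: "(bool list \<Rightarrow> nat) \<Rightarrow> bool list \<Rightarrow> bool list set" where
  "block \<mu> w = words (letters \<mu> w) (\<mu> w)"

lemma finite_block [simp]: "finite (block \<mu> w)"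
  by (simp add: block_def)

lemma letters_cong:
  "(\<And>j. j < length w \<Longrightarrow> \<mu> (take j w) = \<nu> (take j w)) \<Longrightarrow> letters \<mu> w = letters \<nu> w"
  by (auto simp: letters_def fun_eq_iff)

lemma block_cong:
  assumes "\<And>j. j \<le> length w \<Longrightarrow> \<mu> (take j w) = \<nu> (take j w)"
  shows "block \<mu> w = block \<nu> w"
proof -
  have "letters \<mu> w = letters \<nu> w"
    by (rule letters_cong) (use assms in simp)
  moreover have "\<mu> w = \<nu> w"
    using assms[of "length w"] by simp
  ultimately show ?thesis
    by (simp add: block_def)
qed

lemma letters_nonempty:
  assumes "inj_on (\<lambda>j. \<mu> (take j w)) {..<length w}"
  shows "letters \<mu> w i \<noteq> {}"
proof (cases "\<exists>j<length w. i = \<mu> (take j w)")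
  case True
  then obtain j where j: "j < length w" "i = \<mu> (take j w)" by blast
  have "k = j" if "k < length w" "i = \<mu> (take k w)" for k
    using inj_onD[OF assms, of k j] that j by simp
  then have "w ! j \<in> letters \<mu> w i"
    unfolding letters_def by blast
  then show ?thesis by blast
qed (auto simp: letters_def)

definition haar_vector :: "bool list \<Rightarrow> SL_inf" where
  "haar_vector w = haar_series (word_interval w)"

lemma haar_coeff_haar_vector [simp]: "haar_coeff (haar_vector v) w = (if w = v then 1 else 0)"
  by (simp add: haar_vector_def)

definition block_vector :: "bool list set \<Rightarrow> (bool list \<Rightarrow> real) \<Rightarrow> SL_inf" where
  "block_vector B \<sigma> = (\<Sum>K\<in>B. \<sigma> K *\<^sub>R haar_vector K)"

definition block_mean :: "bool list set \<Rightarrow> (bool list \<Rightarrow> real) \<Rightarrow> SL_inf \<Rightarrow> real" where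
  "block_mean B \<tau> g = mean B (\<lambda>K. \<tau> K * haar_coeff g K)"

lemma haar_coeff_block_vector:
  "finite B \<Longrightarrow> haar_coeff (block_vector B \<sigma>) K = (if K \<in> B then \<sigma> K else 0)"
  by (simp add: block_vector_def haar_coeff_sum if_distrib cong: if_cong)

lemma block_mean_add: "block_mean B \<tau> (f + g) = block_mean B \<tau> f + block_mean B \<tau> g"
  by (simp add: block_mean_def mean_def distrib_left sum.distrib add_divide_distrib)

lemma block_mean_scaleR: "block_mean B \<tau> (r *\<^sub>R g) = r * block_mean B \<tau> g"
  by (simp add: block_mean_def mean_def sum_distrib_left mult.left_commute)

lemma abs_block_mean_le:
  assumes "\<And>K. \<bar>\<tau> K\<bar> = 1"
  shows "\<bar>block_mean B \<tau> g\<bar> \<le> mean B (\<lambda>K. \<bar>haar_coeff g K\<bar>)"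
proof -
  have "\<bar>\<Sum>K\<in>B. \<tau> K * haar_coeff g K\<bar> \<le> (\<Sum>K\<in>B. \<bar>\<tau> K * haar_coeff g K\<bar>)"
    by (rule sum_abs)
  then show ?thesis
    by (simp add: block_mean_def mean_def divide_right_mono abs_mult assms)
qed

lemma bounded_linear_block_mean:
  assumes "\<And>K. \<bar>\<tau> K\<bar> = 1"
  shows "bounded_linear (block_mean B \<tau>)"
proof (rule bounded_linear_intro)
  show "norm (block_mean B \<tau> g) \<le> norm g * 1" for g
  proof -
    have "\<bar>block_mean B \<tau> g\<bar> \<le> mean B (\<lambda>K. \<bar>haar_coeff g K\<bar>)"
      by (rule abs_block_mean_le[OF assms])
    also have "\<dots> \<le> mean B (\<lambda>K. norm g)"
      by (intro mean_mono haar_coeff_le_norm)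
    also have "\<dots> \<le> norm g"
      by (rule mean_const_le) simp
    finally show ?thesis by simp
  qed
qed (simp_all add: block_mean_add block_mean_scaleR)

section \<open>Operators given by block bases\<close>

text \<open>Since the coefficients need only satisfy a bound on each chain, an operator may be prescribed coefficient by
  coefficient, without any convergence.\<close>
lemma operator_of_coefficients:
  assumes C: "0 \<le> C"
    and add: "\<And>f g w. A (f + g) w = A f w + A g w"
    and scale: "\<And>r f w. A (r *\<^sub>R f) w = r * A f w"
    and bound: "\<And>g w. chain_square (A g) w \<le> (C * norm g)\<^sup>2"
  shows "\<exists>L. bounded_linear L \<and> (\<forall>g w. haar_coeff (L g) w = A g w) \<and> (\<forall>g. norm (L g) \<le> C * norm g)"
proof -
  define L where "L g = of_haar_coeffs (A g)" for g
  have L: "haar_coeff (L g) = A g" for g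
    unfolding L_def using C bound by (intro haar_coeff_of_haar_coeffs[of "C * norm g"]) simp_all
  have norm: "norm (L g) \<le> C * norm g" for g
    using C bound by (simp add: norm_le_iff_chain_square L)
  have "bounded_linear L"
    by (rule bounded_linear_intro[of _ C])
      (auto intro!: SL_inf_eqI simp: L add scale norm mult.commute[of _ C])
  with L norm show ?thesis by (intro exI[of _ L]) simp
qed

text \<open>The order is that of the enumeration and not only the prefix order because the blocks are chosen one after
  another, each beyond the levels of all earlier ones. A level then identifies its word.\<close>
locale levels =
  fixes \<mu> :: "bool list \<Rightarrow> nat"
  assumes mono: "word_rank v < word_rank w \<Longrightarrow> \<mu> v < \<mu> w"
begin

lemma eq_iff: "\<mu> v = \<mu> w \<longleftrightarrow> v = w"
  using mono[of v w] mono[of w v] rank_eq_iff[of v w] by (metis less_irrefl linorder_neqE_nat)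

lemma letters_ne: "letters \<mu> w i \<noteq> {}"
proof (rule letters_nonempty, rule inj_onI)
  fix i j assume "i \<in> {..<length w}" "j \<in> {..<length w}" "\<mu> (take i w) = \<mu> (take j w)"
  then show "i = j"
    unfolding eq_iff by (auto dest: arg_cong[where f = length])
qed

lemma block_unique: "K \<in> block \<mu> v \<Longrightarrow> K \<in> block \<mu> w \<Longrightarrow> v = w"
  using eq_iff[of v w] by (auto simp: block_def words_def)

lemma nth_block:
  assumes "K \<in> block \<mu> w" "j < length w"
  shows "K ! \<mu> (take j w) = w ! j"
proof -
  have "K ! \<mu> (take j w) \<in> letters \<mu> w (\<mu> (take j w))"
    using assms mono[OF rank_take_less[OF assms(2)]] by (simp add: block_def words_def)
  with assms(2) show ?thesis
    by (simp add: letters_def)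
qed

text \<open>The letters prescribed by the longer word \<open>w\<close> and not by its prefix sit at or beyond the level of the
  prefix. So the blocks of all prefixes of \<open>w\<close> are governed by one constraint.\<close>
lemma block_take:
  assumes "j \<le> length w"
  shows "block \<mu> (take j w) = words (letters \<mu> w) (\<mu> (take j w))"
  unfolding block_def
proof (rule words_cong)
  fix i assume i: "i < \<mu> (take j w)"
  have "k < j" if "k < length w" "i = \<mu> (take k w)" for k
  proof (rule ccontr)
    assume "\<not> k < j"
    then have "\<mu> (take j w) \<le> i"
      using that mono[OF rank_take_mono[of j k w]] by (cases "j = k") auto
    with i show False by simp
  qed
  moreover have "k < length w" if "k < j" for k
    using that assms by simp
  ultimately have "(\<forall>k<j. i = \<mu> (take k w) \<longrightarrow> b = w ! k)
      \<longleftrightarrow> (\<forall>k<length w. i = \<mu> (take k w) \<longrightarrow> b = w ! k)" for b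
    by blast
  then show "letters \<mu> (take j w) i = letters \<mu> w i"
    using assms by (simp add: letters_def min_absorb1 min_absorb2)
qed

text \<open>A word \<open>K\<close> determines the letters of \<open>w\<close> from its own letters at the levels of the prefixes
  of \<open>w\<close>. Therefore the words whose blocks are met by prefixes of one \<open>K\<close> form a chain.\<close>
lemma prefix_of_block:
  assumes v: "take (\<mu> v) K \<in> block \<mu> v" and w: "take (\<mu> w) K \<in> block \<mu> w"
    and len: "length v \<le> length w"
  shows "v = take (length v) w"
proof -
  have "i \<le> length v \<longrightarrow> take i v = take i w" for i
  proof (induction i)
    case (Suc i)
    show ?case
    proof
      assume i: "Suc i \<le> length v"
      then have eq: "take i v = take i w" using Suc by simp
      have "v ! i = K ! \<mu> (take i v)"
        using nth_block[OF v, of i] mono[OF rank_take_less[of i v]] i by simp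
      also have "\<dots> = w ! i"
        using nth_block[OF w, of i] mono[OF rank_take_less[of i w]] i len by (simp add: eq)
      finally show "take (Suc i) v = take (Suc i) w"
        using i len eq by (simp add: take_Suc_conv_app_nth)
    qed
  qed simp
  from this[of "length v"] show ?thesis by simp
qed

text \<open>Along the prefixes of a fixed word \<open>K\<close> the series \<open>R g\<close> has, up to signs, coefficients of \<open>g\<close> at distinct
  words of a chain; hence the norm bound.\<close>
lemma block_embedding:
  assumes \<sigma>: "\<And>w K. \<bar>\<sigma> w K\<bar> = 1"
  shows "\<exists>R. bounded_linear R \<and> (\<forall>g. norm (R g) \<le> norm g)
    \<and> (\<forall>v. R (haar_vector v) = block_vector (block \<mu> v) (\<sigma> v))
    \<and> (\<forall>g N. (\<forall>w. haar_coeff g w \<noteq> 0 \<longrightarrow> \<mu> w \<in> N) \<longrightarrow> supported_on N (R g))"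
proof -
  \<comment> \<open>the index of the block that contains \<open>K\<close>, if there is one\<close>
  define address where "address K = (THE w. K \<in> block \<mu> w)" for K
  have address: "address K = w" if "K \<in> block \<mu> w" for K w
    unfolding address_def using that block_unique by blast
  define A where "A g K = (if \<exists>w. K \<in> block \<mu> w
    then \<sigma> (address K) K * haar_coeff g (address K) else 0)" for g K
  have bound: "chain_square (A g) K \<le> (1 * norm g)\<^sup>2" for g K
  proof -
    define J where "J = {w. take (\<mu> w) K \<in> block \<mu> w}"
    define s where "s = {j\<in>{..length K}. A g (take j K) \<noteq> 0}"
    have s: "\<exists>w\<in>J. \<mu> w = j \<and> (A g (take j K))\<^sup>2 = (haar_coeff g w)\<^sup>2" if "j \<in> s" for j
    proof -
      from that obtain w where w: "take j K \<in> block \<mu> w"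
        by (auto simp: s_def A_def split: if_splits)
      then have "\<mu> w = j"
        using that by (auto simp: s_def block_def words_def)
      moreover have "(\<sigma> w (take j K))\<^sup>2 = 1"
        using \<sigma>[of w "take j K"] by (metis abs_1 one_power2 power2_abs)
      then have "(A g (take j K))\<^sup>2 = (haar_coeff g w)\<^sup>2"
        using w address[OF w] by (auto simp: A_def power_mult_distrib)
      ultimately show ?thesis
        using w by (auto simp: J_def)
    qed
    have eq: "chain_square (A g) K = (\<Sum>j\<in>s. (A g (take j K))\<^sup>2)"
      unfolding chain_square_def s_def by (rule sum.mono_neutral_right) auto
    show ?thesis
    proof (cases "s = {}")
      case False
      have "J \<subseteq> \<mu> -` {..length K}"
        by (auto simp: J_def block_def words_def)
      then have "finite J"
        by (rule finite_subset) (intro finite_vimageI, auto simp: inj_def eq_iff)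
      moreover have "J \<noteq> {}"
        using s False by blast
      ultimately have "Max (length ` J) \<in> length ` J"
        by (intro Max_in) auto
      then obtain w where w: "w \<in> J" "length w = Max (length ` J)"
        by auto
      have longest: "length v \<le> length w" if "v \<in> J" for v
        unfolding w(2) using that \<open>finite J\<close> by (intro Max_ge) auto
      have "(\<Sum>j\<in>s. (A g (take j K))\<^sup>2) \<le> chain_square (haar_coeff g) w"
        unfolding chain_square_def
      proof (rule sum_le_included[where i = "\<lambda>i. \<mu> (take i w)"])
        show "\<forall>j\<in>s. \<exists>i\<in>{..length w}. \<mu> (take i w) = j \<and> (A g (take j K))\<^sup>2 \<le> (haar_coeff g (take i w))\<^sup>2"
        proof
          fix j assume "j \<in> s"
          then obtain v where v: "v \<in> J" "\<mu> v = j" "(A g (take j K))\<^sup>2 = (haar_coeff g v)\<^sup>2"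
            using s by blast
          then have "v = take (length v) w"
            using w longest by (intro prefix_of_block[of _ K]) (auto simp: J_def)
          with v longest[OF v(1)] show "\<exists>i\<in>{..length w}. \<mu> (take i w) = j \<and> (A g (take j K))\<^sup>2 \<le> (haar_coeff g (take i w))\<^sup>2"
            by (intro bexI[of _ "length v"]) auto
        qed
      qed (auto simp: s_def)
      with eq chain_square_le_norm[of g w] show ?thesis by simp
    qed (simp add: eq)
  qed
  have "\<exists>R. bounded_linear R \<and> (\<forall>g w. haar_coeff (R g) w = A g w) \<and> (\<forall>g. norm (R g) \<le> 1 * norm g)"
    by (rule operator_of_coefficients[OF _ _ _ bound]) (auto simp: A_def algebra_simps)
  then obtain R where R: "bounded_linear R" "\<And>g w. haar_coeff (R g) w = A g w" "\<And>g. norm (R g) \<le> norm g"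
    by auto
  have "R (haar_vector v) = block_vector (block \<mu> v) (\<sigma> v)" for v
    by (rule SL_inf_eqI) (auto simp: R(2) A_def haar_coeff_block_vector address)
  moreover have "supported_on N (R g)" if "\<And>w. haar_coeff g w \<noteq> 0 \<Longrightarrow> \<mu> w \<in> N" for g N
    unfolding supported_on_def
  proof (intro allI impI, rule ccontr)
    fix K assume K: "length K \<notin> N" "haar_coeff (R g) K \<noteq> 0"
    then obtain w where w: "K \<in> block \<mu> w"
      by (auto simp: R(2) A_def split: if_splits)
    then have "haar_coeff g w \<noteq> 0"
      using K(2) address[OF w] by (auto simp: R(2) A_def split: if_splits)
    moreover have "\<mu> w = length K"
      using w by (simp add: block_def words_def)
    ultimately show False using that K(1) by metis
  qed
  ultimately show ?thesis using R by blast
qed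

text \<open>The square of a mean is at most the mean of the squares, and by uniform distribution
  the means of squares over the blocks of a chain are controlled by a single chain sum. The factors
  \<open>c w\<close> leave room for dividing by the diagonal of an operator.\<close>
lemma block_projection:
  assumes \<tau>: "\<And>w K. \<bar>\<tau> w K\<bar> = 1" and c: "\<And>w. \<bar>c w\<bar> \<le> C"
  shows "\<exists>Q. bounded_linear Q
    \<and> (\<forall>g w. haar_coeff (Q g) w = c w * block_mean (block \<mu> w) (\<tau> w) g)
    \<and> (\<forall>g. norm (Q g) \<le> C * norm g)"
proof (rule operator_of_coefficients)
  show "0 \<le> C" using c[of "[]"] by linarith
  fix g w
  have coeff_bound: "(c v * block_mean (block \<mu> v) (\<tau> v) g)\<^sup>2
      \<le> C\<^sup>2 * mean (block \<mu> v) (\<lambda>K. (haar_coeff g K)\<^sup>2)" for v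
  proof -
    have "\<bar>block_mean (block \<mu> v) (\<tau> v) g\<bar>\<^sup>2 \<le> (mean (block \<mu> v) (\<lambda>K. \<bar>haar_coeff g K\<bar>))\<^sup>2"
      by (intro power_mono abs_block_mean_le \<tau>) simp
    also have "\<dots> \<le> mean (block \<mu> v) (\<lambda>K. (haar_coeff g K)\<^sup>2)"
      using mean_square_le[of "block \<mu> v" "\<lambda>K. \<bar>haar_coeff g K\<bar>"] by simp
    finally have "(block_mean (block \<mu> v) (\<tau> v) g)\<^sup>2 \<le> mean (block \<mu> v) (\<lambda>K. (haar_coeff g K)\<^sup>2)"
      by simp
    moreover have "(c v)\<^sup>2 \<le> C\<^sup>2"
      using c[of v] by (metis abs_ge_zero power2_abs power_mono)
    ultimately show ?thesis
      unfolding power_mult_distrib by (intro mult_mono) simp_all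
  qed
  have inj: "inj_on (\<lambda>j. \<mu> (take j w)) {..length w}"
    by (rule inj_onI) (auto simp: eq_iff dest: arg_cong[where f = length])
  have le: "\<mu> (take j w) \<le> \<mu> w" if "j \<in> {..length w}" for j
    using mono[OF rank_take_less, of j w] that by (cases "j = length w") auto
  have "chain_square (\<lambda>w. c w * block_mean (block \<mu> w) (\<tau> w) g) w
      \<le> (\<Sum>j\<le>length w. C\<^sup>2 * mean (block \<mu> (take j w)) (\<lambda>K. (haar_coeff g K)\<^sup>2))"
    unfolding chain_square_def by (intro sum_mono coeff_bound)
  also have "\<dots> = C\<^sup>2 * (\<Sum>j\<le>length w. mean (words (letters \<mu> w) (\<mu> (take j w))) (\<lambda>K. (haar_coeff g K)\<^sup>2))"
    by (simp add: block_take sum_distrib_left)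
  also have "\<dots> \<le> C\<^sup>2 * (norm g)\<^sup>2"
    by (intro mult_left_mono sum_mean_square_le[OF letters_ne _ le inj]) simp_all
  finally show "chain_square (\<lambda>w. c w * block_mean (block \<mu> w) (\<tau> w) g) w \<le> (C * norm g)\<^sup>2"
    by (simp add: power_mult_distrib)
qed (simp_all add: block_mean_add block_mean_scaleR algebra_simps)

end

section \<open>Choosing the blocks\<close>

text \<open>What is chosen for one word: the level of its block, the signs with which the block is embedded, the signs
  with which it is averaged, and the infinite set of levels left for all later words.\<close>
datatype stage =
  Stage (level: nat) (in_sign: "bool list \<Rightarrow> real") (out_sign: "bool list \<Rightarrow> real") (reserve: "nat set")

definition stage_vector :: "(bool list \<Rightarrow> stage) \<Rightarrow> bool list \<Rightarrow> SL_inf" where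
  "stage_vector s w = block_vector (block (\<lambda>v. level (s v)) w) (in_sign (s w))"

text \<open>The requirements on the stage \<open>r\<close> for \<open>w\<close>, given the stages \<open>s\<close> of the earlier words. Here
  \<open>\<Lambda> g\<close> is the coefficient at \<open>w\<close> of the averaged series \<open>T g\<close>. The last three requirements are that
  the diagonal be large, that the earlier blocks contribute little to \<open>\<Lambda>\<close>, and that everything supported on
  the levels left for later words contribute little.\<close>
definition admissible ::
  "(SL_inf \<Rightarrow> SL_inf) \<Rightarrow> real \<Rightarrow> (bool list \<Rightarrow> real) \<Rightarrow> (bool list \<Rightarrow> stage) \<Rightarrow> bool list \<Rightarrow> stage \<Rightarrow> bool"
where
  "admissible T \<delta> \<epsilon> s w r \<longleftrightarrow>
    (let B = words (letters (\<lambda>v. level (s v)) w) (level r); \<Lambda> = \<lambda>g. block_mean B (out_sign r) (T g) in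
      (\<forall>v. word_rank v < word_rank w \<longrightarrow> level r \<in> reserve (s v) \<and> reserve r \<subseteq> reserve (s v)) \<and>
      infinite (reserve r) \<and> (\<forall>n\<in>reserve r. level r < n) \<and>
      (\<forall>K. \<bar>in_sign r K\<bar> = 1 \<and> \<bar>out_sign r K\<bar> = 1) \<and>
      \<delta> \<le> \<Lambda> (block_vector B (in_sign r)) \<and>
      (\<Sum>v | word_rank v < word_rank w. \<bar>\<Lambda> (stage_vector s v)\<bar>) \<le> \<epsilon> w \<and>
      (\<forall>g. supported_on (reserve r) g \<longrightarrow> \<bar>\<Lambda> g\<bar> \<le> \<epsilon> w * norm g))"

lemma stage_vector_cong:
  assumes "\<And>u. word_rank u \<le> word_rank v \<Longrightarrow> s u = t u"
  shows "stage_vector s v = stage_vector t v"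
proof -
  have "s (take j v) = t (take j v)" if "j \<le> length v" for j
    using assms rank_take_less[of j v] that by (cases "j = length v") auto
  then have "block (\<lambda>v. level (s v)) v = block (\<lambda>v. level (t v)) v"
    by (intro block_cong) simp
  then show ?thesis
    using assms[of v] by (simp add: stage_vector_def)
qed

lemma admissible_cong:
  assumes "\<And>v. word_rank v < word_rank w \<Longrightarrow> s v = t v"
  shows "admissible T \<delta> \<epsilon> s w r = admissible T \<delta> \<epsilon> t w r"
proof -
  have 1: "letters (\<lambda>v. level (s v)) w = letters (\<lambda>v. level (t v)) w"
    by (intro letters_cong) (simp add: assms rank_take_less)
  have 2: "stage_vector s v = stage_vector t v" if "word_rank v < word_rank w" for v
    using that by (intro stage_vector_cong) (simp add: assms)
  have 3: "(\<Sum>v | word_rank v < word_rank w. \<bar>g (stage_vector s v)\<bar>) = (\<Sum>v | word_rank v < word_rank w. \<bar>g (stage_vector t v)\<bar>)"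
    for g :: "SL_inf \<Rightarrow> real"
    by (intro sum.cong) (simp_all add: 2)
  have 4: "(\<forall>v. word_rank v < word_rank w \<longrightarrow> level r \<in> reserve (s v) \<and> reserve r \<subseteq> reserve (s v))
      \<longleftrightarrow> (\<forall>v. word_rank v < word_rank w \<longrightarrow> level r \<in> reserve (t v) \<and> reserve r \<subseteq> reserve (t v))"
    using assms by simp
  show ?thesis
    unfolding admissible_def Let_def 1 3 4 by (rule refl)
qed

text \<open>The reserves decrease along the enumeration, so the latest one is contained in all the others.\<close>
lemma common_reserve:
  assumes "\<And>v. word_rank v < word_rank w \<Longrightarrow> admissible T \<delta> \<epsilon> s v (s v)"
  shows "\<exists>N. infinite N \<and> (\<forall>v. word_rank v < word_rank w \<longrightarrow> N \<subseteq> reserve (s v))"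
proof (cases "\<exists>v. word_rank v < word_rank w")
  case True
  then have ne: "word_rank ` {v. word_rank v < word_rank w} \<noteq> {}" by auto
  then have "Max (word_rank ` {v. word_rank v < word_rank w}) \<in> word_rank ` {v. word_rank v < word_rank w}"
    by (intro Max_in) auto
  then obtain u where u: "word_rank u < word_rank w" "word_rank u = Max (word_rank ` {v. word_rank v < word_rank w})"
    by auto
  have "reserve (s u) \<subseteq> reserve (s v)" if "word_rank v < word_rank w" for v
  proof (cases "v = u")
    case False
    have "word_rank v \<le> word_rank u"
      unfolding u(2) using that by (intro Max_ge) auto
    with False have "word_rank v < word_rank u"
      using rank_eq_iff[of v u] by linarith
    then show ?thesis
      using assms[OF u(1)] by (simp add: admissible_def Let_def)
  qed simp
  moreover have "infinite (reserve (s u))"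
    using assms[OF u(1)] by (simp add: admissible_def Let_def)
  ultimately show ?thesis by blast
qed (auto intro: infinite_UNIV_nat)

text \<open>Multiplying the embedding signs by the signs \<open>\<theta>\<close> of the diagonal entries of \<open>T\<close> makes the diagonal
  positive. The block mean is then \<open>1 / card B\<close> times a quadratic form in the remaining signs
  whose trace is at least \<open>card B * \<delta>\<close>.\<close>
lemma exists_signs_large_block_mean:
  assumes T: "bounded_linear T" and \<delta>: "0 < \<delta>"
    and diag: "\<And>K. \<delta> \<le> \<bar>haar_coeff (T (haar_vector K)) K\<bar>"
    and B: "finite B" "B \<noteq> {}"
  shows "\<exists>\<sigma> \<tau>. (\<forall>K. \<bar>\<sigma> K\<bar> = 1 \<and> \<bar>\<tau> K\<bar> = 1) \<and> \<delta> \<le> block_mean B \<tau> (T (block_vector B \<sigma>))"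
proof -
  interpret T: bounded_linear T by fact
  define a where "a K L = haar_coeff (T (haar_vector K)) L" for K L
  define \<theta> where "\<theta> K = sgn (a K K)" for K
  have \<theta>: "\<bar>\<theta> K\<bar> = 1" "\<theta> K * a K K = \<bar>a K K\<bar>" for K
  proof -
    show "\<bar>\<theta> K\<bar> = 1"
      using diag[of K] \<delta> by (auto simp: \<theta>_def a_def abs_sgn_eq)
    show "\<theta> K * a K K = \<bar>a K K\<bar>"
      by (simp add: \<theta>_def abs_sgn mult.commute)
  qed
  obtain \<tau> where \<tau>: "\<And>K. \<bar>\<tau> K\<bar> = 1"
    "(\<Sum>K\<in>B. \<theta> K * a K K) \<le> (\<Sum>K\<in>B. \<Sum>L\<in>B. \<tau> K * \<tau> L * (\<theta> K * a K L))"
    using exists_signs_sum_ge_diagonal[OF B(1), of "\<lambda>K L. \<theta> K * a K L"] by blast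
  define \<sigma> where "\<sigma> K = \<theta> K * \<tau> K" for K
  have "haar_coeff (T (block_vector B \<sigma>)) L = (\<Sum>K\<in>B. \<sigma> K * a K L)" for L
    by (simp add: block_vector_def T.sum T.scaleR haar_coeff_sum a_def)
  then have "block_mean B \<tau> (T (block_vector B \<sigma>)) = (\<Sum>L\<in>B. \<Sum>K\<in>B. \<tau> K * \<tau> L * (\<theta> K * a K L)) / card B"
    by (simp add: block_mean_def mean_def sum_distrib_left \<sigma>_def ac_simps)
  also have "(\<Sum>L\<in>B. \<Sum>K\<in>B. \<tau> K * \<tau> L * (\<theta> K * a K L)) = (\<Sum>K\<in>B. \<Sum>L\<in>B. \<tau> K * \<tau> L * (\<theta> K * a K L))"
    by (rule sum.swap)
  finally have eq: "block_mean B \<tau> (T (block_vector B \<sigma>))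
      = (\<Sum>K\<in>B. \<Sum>L\<in>B. \<tau> K * \<tau> L * (\<theta> K * a K L)) / card B" .
  have "\<delta> \<le> \<theta> K * a K K" for K
    using diag[of K] unfolding \<theta>(2) by (simp add: a_def)
  then have "card B * \<delta> \<le> (\<Sum>K\<in>B. \<theta> K * a K K)"
    using sum_mono[of B "\<lambda>_. \<delta>" "\<lambda>K. \<theta> K * a K K"] by simp
  also note \<tau>(2)
  finally have "\<delta> \<le> block_mean B \<tau> (T (block_vector B \<sigma>))"
    using B unfolding eq by (subst pos_le_divide_eq) (simp_all add: card_gt_0_iff mult.commute)
  moreover have "\<bar>\<sigma> K\<bar> = 1" for K
    by (simp add: \<sigma>_def abs_mult \<theta> \<tau>(1))
  ultimately show ?thesis
    using \<tau>(1) by blast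
qed

text \<open>The level is taken from the common reserve and so high that the earlier vectors have small means. This
  bound does not depend on the signs, which can therefore be chosen afterwards for the sake of the
  diagonal. Once level and signs are fixed, \<open>\<Lambda>\<close> is a fixed functional and the reserve can be
  thinned out to make it small.\<close>
lemma exists_admissible_stage:
  assumes T: "bounded_linear T" and \<delta>: "0 < \<delta>" and \<epsilon>: "0 < \<epsilon> w"
    and diag: "\<And>K. \<delta> \<le> \<bar>haar_coeff (T (haar_vector K)) K\<bar>"
    and hist: "\<And>v. word_rank v < word_rank w \<Longrightarrow> admissible T \<delta> \<epsilon> s v (s v)"
  shows "\<exists>r. admissible T \<delta> \<epsilon> s w r"
proof -
  define p where "p = letters (\<lambda>v. level (s v)) w"
  have p: "p i \<noteq> {}" for i
    unfolding p_def
  proof (rule letters_nonempty, rule linorder_inj_onI')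
    fix i j assume "i \<in> {..<length w}" "j \<in> {..<length w}" "i < j"
    then have "word_rank (take i w) < word_rank (take j w)" "word_rank (take j w) < word_rank w"
      by (auto intro: rank_take_mono rank_take_less)
    with hist[of "take i w"] hist[of "take j w"] show "level (s (take i w)) \<noteq> level (s (take j w))"
      by (fastforce simp: admissible_def Let_def)
  qed
  obtain N where N: "infinite N" "\<And>v. word_rank v < word_rank w \<Longrightarrow> N \<subseteq> reserve (s v)"
    using common_reserve[OF hist] by blast
  define F where "F m = (\<Sum>v | word_rank v < word_rank w. mean (words p m) (\<lambda>K. \<bar>haar_coeff (T (stage_vector s v)) K\<bar>))" for m
  have "F \<longlonglongrightarrow> (\<Sum>v | word_rank v < word_rank w. 0)"
    unfolding F_def by (intro tendsto_sum mean_abs_haar_coeff_tendsto_0 p)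
  then have "\<forall>\<^sub>F m in sequentially. F m < \<epsilon> w"
    using \<epsilon> by (intro order_tendstoD(2)) auto
  then obtain M where M: "\<And>m. m \<ge> M \<Longrightarrow> F m < \<epsilon> w"
    by (auto simp: eventually_sequentially)
  obtain m where m: "m \<in> N" "m \<ge> M"
    using N(1) by (auto simp: infinite_nat_iff_unbounded_le)
  define B where "B = words p m"
  have B: "finite B" "B \<noteq> {}"
    by (simp_all add: B_def words_nonempty p)
  obtain \<sigma> \<tau> where \<sigma>: "\<And>K. \<bar>\<sigma> K\<bar> = 1" and \<tau>: "\<And>K. \<bar>\<tau> K\<bar> = 1"
    and large: "\<delta> \<le> block_mean B \<tau> (T (block_vector B \<sigma>))"
    using exists_signs_large_block_mean[OF T \<delta> diag B] by blast
  have early: "(\<Sum>v | word_rank v < word_rank w. \<bar>block_mean B \<tau> (T (stage_vector s v))\<bar>) \<le> \<epsilon> w"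
  proof -
    have "(\<Sum>v | word_rank v < word_rank w. \<bar>block_mean B \<tau> (T (stage_vector s v))\<bar>) \<le> F m"
      unfolding F_def B_def by (intro sum_mono abs_block_mean_le \<tau>)
    with M[OF m(2)] show ?thesis by simp
  qed
  have "infinite (N - {..m})"
    using N(1) by simp
  moreover have "bounded_linear (\<lambda>g. block_mean B \<tau> (T g))"
    using bounded_linear_compose[OF bounded_linear_block_mean[OF \<tau>] T] .
  ultimately obtain N' where N': "N' \<subseteq> N - {..m}" "infinite N'"
    "\<And>g. supported_on N' g \<Longrightarrow> \<bar>block_mean B \<tau> (T g)\<bar> \<le> \<epsilon> w * norm g"
    using functional_small_on_sparse_levels[OF _ _ \<epsilon>] by meson
  have N'_subset: "N' \<subseteq> reserve (s v)" if "word_rank v < word_rank w" for v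
    using N(2)[OF that] N'(1) by blast
  have "admissible T \<delta> \<epsilon> s w (Stage m \<sigma> \<tau> N')"
    unfolding admissible_def Let_def stage.sel p_def[symmetric] B_def[symmetric]
    using N(2) m N' N'_subset \<sigma> \<tau> large early by (intro conjI) auto
  then show ?thesis by blast
qed

lemma exists_admissible_system:
  assumes T: "bounded_linear T" and \<delta>: "0 < \<delta>" and \<epsilon>: "\<And>w. 0 < \<epsilon> w"
    and diag: "\<And>K. \<delta> \<le> \<bar>haar_coeff (T (haar_vector K)) K\<bar>"
  shows "\<exists>s. \<forall>w. admissible T \<delta> \<epsilon> s w (s w)"
proof (rule dependent_wf_choice[where R = "Wellfounded.measure word_rank"])
  show "\<exists>r. admissible T \<delta> \<epsilon> s w r"
    if "\<And>v. (v, w) \<in> Wellfounded.measure word_rank \<Longrightarrow> admissible T \<delta> \<epsilon> s v (s v)" for w s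
    using that by (intro exists_admissible_stage assms) simp
qed (auto intro!: admissible_cong)

section \<open>Factorization\<close>

lemma sum_power_half_square_le: "(\<Sum>j\<le>n. ((1 / 2 :: real) ^ (j + 1))\<^sup>2) \<le> 1"
proof -
  have "(\<Sum>j\<le>n. ((1 / 2 :: real) ^ (j + 1))\<^sup>2) \<le> 1 - (1 / 2) ^ (n + 1)"
  proof (induction n)
    case (Suc n)
    have "(1 / 2 :: real) ^ (n + 2) \<le> 1"
      by (rule power_le_one) simp_all
    then have "((1 / 2 :: real) ^ (n + 2))\<^sup>2 \<le> (1 / 2) ^ (n + 2)"
      unfolding power2_eq_square by (rule mult_left_le) simp
    with Suc show ?case by simp
  qed (simp add: power2_eq_square)
  also have "\<dots> \<le> 1" by simp
  finally show ?thesis .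
qed

text \<open>A series is its part at the finitely many earlier words, plus one term at \<open>w\<close>, plus a rest at later
  words. The finite part is handled by its Haar coefficients; the rest, which is in general no limit of
  finite sums, is handled as a whole.\<close>
lemma functional_almost_diagonal:
  assumes \<Lambda>: "bounded_linear \<Lambda>" and R: "bounded_linear R" "\<And>f. norm (R f) \<le> norm f"
    and early: "(\<Sum>v | word_rank v < word_rank w. \<bar>\<Lambda> (R (haar_vector v))\<bar>) \<le> \<epsilon>"
    and late: "\<And>f. (\<And>v. haar_coeff f v \<noteq> 0 \<Longrightarrow> word_rank w < word_rank v) \<Longrightarrow> \<bar>\<Lambda> (R f)\<bar> \<le> \<epsilon> * norm (R f)"
  shows "\<bar>\<Lambda> (R g) - haar_coeff g w * \<Lambda> (R (haar_vector w))\<bar> \<le> 2 * \<epsilon> * norm g"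
proof -
  interpret \<Lambda>: bounded_linear \<Lambda> by fact
  interpret R: bounded_linear R by fact
  define P where "P = {v. word_rank v < word_rank w}"
  have fin: "finite P" by (simp add: P_def)
  have \<epsilon>: "0 \<le> \<epsilon>"
    by (rule order_trans[OF _ early]) (simp add: sum_nonneg)
  define a where "a v = (if word_rank w < word_rank v then haar_coeff g v else 0)" for v
  have a: "chain_square a u \<le> (norm g)\<^sup>2" for u
    by (rule order_trans[OF chain_square_mono chain_square_le_norm]) (simp add: a_def)
  define h where "h = of_haar_coeffs a"
  have h: "haar_coeff h = a"
    unfolding h_def by (rule haar_coeff_of_haar_coeffs[OF norm_ge_zero a])
  have norm_h: "norm h \<le> norm g"
    using a by (simp add: norm_le_iff_chain_square h)
  have g: "g = (\<Sum>v\<in>P. haar_coeff g v *\<^sub>R haar_vector v) + haar_coeff g w *\<^sub>R haar_vector w + h"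
  proof (rule SL_inf_eqI)
    fix u
    have "(\<Sum>v\<in>P. haar_coeff g v * (if u = v then 1 else 0)) = (if u \<in> P then haar_coeff g u else 0)"
      using fin by (simp add: if_distrib cong: if_cong)
    moreover have "word_rank u < word_rank w \<or> u = w \<or> word_rank w < word_rank u"
      using rank_eq_iff[of u w] by linarith
    ultimately show "haar_coeff g u = haar_coeff ((\<Sum>v\<in>P. haar_coeff g v *\<^sub>R haar_vector v) + haar_coeff g w *\<^sub>R haar_vector w + h) u"
      by (auto simp: haar_coeff_sum h a_def P_def)
  qed
  have "\<Lambda> (R g) = (\<Sum>v\<in>P. haar_coeff g v * \<Lambda> (R (haar_vector v)))
      + haar_coeff g w * \<Lambda> (R (haar_vector w)) + \<Lambda> (R h)"
    by (subst g) (simp add: R.add R.sum R.scaleR \<Lambda>.add \<Lambda>.sum \<Lambda>.scaleR)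
  then have eq: "\<Lambda> (R g) - haar_coeff g w * \<Lambda> (R (haar_vector w))
      = (\<Sum>v\<in>P. haar_coeff g v * \<Lambda> (R (haar_vector v))) + \<Lambda> (R h)"
    by simp
  have "\<bar>\<Sum>v\<in>P. haar_coeff g v * \<Lambda> (R (haar_vector v))\<bar> \<le> (\<Sum>v\<in>P. norm g * \<bar>\<Lambda> (R (haar_vector v))\<bar>)"
    by (intro sum_abs[THEN order_trans] sum_mono) (simp add: abs_mult mult_right_mono haar_coeff_le_norm)
  also have "\<dots> \<le> norm g * \<epsilon>"
    unfolding sum_distrib_left[symmetric] using early by (intro mult_left_mono) (simp_all add: P_def)
  finally have 1: "\<bar>\<Sum>v\<in>P. haar_coeff g v * \<Lambda> (R (haar_vector v))\<bar> \<le> \<epsilon> * norm g"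
    by (simp add: mult.commute)
  have "\<bar>\<Lambda> (R h)\<bar> \<le> \<epsilon> * norm (R h)"
    by (rule late) (auto simp: h a_def split: if_splits)
  also have "\<dots> \<le> \<epsilon> * norm g"
    using R(2)[of h] norm_h \<epsilon> by (intro mult_left_mono) auto
  finally show ?thesis
    unfolding eq using 1 by linarith
qed

text \<open>With \<open>U = Q \<circ> T \<circ> R\<close>, where \<open>Q\<close> includes the division by the diagonal entries \<open>d w\<close>,
  the tolerances \<open>\<epsilon> w\<close> are so small that \<open>U\<close> differs from the identity by at most \<open>q\<close>. The left
  inverse \<open>V\<close> of \<open>U\<close> gives \<open>S = V \<circ> Q\<close>.\<close>
lemma identity_factors_through_large_diagonal:
  fixes \<delta> \<eta> :: real
  assumes \<delta>: "\<delta> > 0" and \<eta>: "\<eta> > 0" and T: "bounded_linear T"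
    and diag: "\<And>K. \<delta> \<le> \<bar>haar_coeff (T (haar_vector K)) K\<bar>"
  shows "\<exists>R S :: SL_inf \<Rightarrow> SL_inf. bounded_linear R \<and> bounded_linear S \<and> S \<circ> T \<circ> R = id \<and>
    (\<forall>g. norm (R g) \<le> norm g) \<and> (\<forall>g. norm (S g) \<le> (1 + \<eta>) / \<delta> * norm g)"
proof -
  interpret T: bounded_linear T by fact
  \<comment> \<open>chosen so that an inverse of norm at most \<open>1 / (1 - q)\<close> has norm at most \<open>1 + \<eta>\<close>\<close>
  define q where "q = \<eta> / (1 + \<eta>)"
  have q: "0 < q" "q < 1" "1 / (1 - q) = 1 + \<eta>"
    using \<eta> by (auto simp: q_def field_simps)
  \<comment> \<open>the two halves are for the earlier and the later words; the powers make the errors square summable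
    along every chain, and \<open>\<delta>\<close> absorbs the division by the diagonal\<close>
  define \<epsilon> where "\<epsilon> w = q * \<delta> / 2 * (1 / 2) ^ (length w + 1)" for w :: "bool list"
  have \<epsilon>: "0 < \<epsilon> w" for w
    using q \<delta> by (simp add: \<epsilon>_def)
  then obtain s where s: "\<And>w. admissible T \<delta> \<epsilon> s w (s w)"
    using exists_admissible_system[OF T \<delta> _ diag] by blast
  define \<mu> where "\<mu> w = level (s w)" for w
  define \<sigma> where "\<sigma> w = in_sign (s w)" for w
  define \<tau> where "\<tau> w = out_sign (s w)" for w
  define \<Lambda> where "\<Lambda> w g = block_mean (block \<mu> w) (\<tau> w) (T g)" for w g
  note adm = s[unfolded admissible_def Let_def stage_vector_def, folded \<mu>_def \<sigma>_def \<tau>_def,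
      folded block_def, folded \<Lambda>_def]
  have \<sigma>: "\<bar>\<sigma> w K\<bar> = 1" and \<tau>: "\<bar>\<tau> w K\<bar> = 1" for w K
    using adm[of w] by auto
  have nested: "\<mu> w \<in> reserve (s v)" if "word_rank v < word_rank w" for v w
    using adm[of w] that by auto
  interpret levels \<mu>
  proof
    show "\<mu> v < \<mu> w" if "word_rank v < word_rank w" for v w
      using adm[of v] nested[OF that] by auto
  qed
  obtain R where R: "bounded_linear R" "\<And>g. norm (R g) \<le> norm g"
    "\<And>v. R (haar_vector v) = block_vector (block \<mu> v) (\<sigma> v)"
    "\<And>g N. (\<And>w. haar_coeff g w \<noteq> 0 \<Longrightarrow> \<mu> w \<in> N) \<Longrightarrow> supported_on N (R g)"
    using block_embedding[of \<sigma>, OF \<sigma>] by blast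
  define d where "d w = \<Lambda> w (R (haar_vector w))" for w
  have d: "\<delta> \<le> d w" for w
    using adm[of w] by (simp add: d_def R(3))
  obtain Q where Q: "bounded_linear Q"
    "\<And>g w. haar_coeff (Q g) w = 1 / d w * block_mean (block \<mu> w) (\<tau> w) g"
    "\<And>g. norm (Q g) \<le> 1 / \<delta> * norm g"
  proof -
    have "\<bar>1 / d w\<bar> \<le> 1 / \<delta>" for w
      using d[of w] \<delta> by (simp add: frac_le)
    then show ?thesis
      using block_projection[of \<tau> "\<lambda>w. 1 / d w", OF \<tau>] that by blast
  qed
  define U where "U g = Q (T (R g))" for g
  have U: "bounded_linear U"
    unfolding U_def[abs_def] by (intro bounded_linear_compose[OF Q(1)] bounded_linear_compose[OF T] R(1))
  have entry: "\<bar>haar_coeff (U g - g) w\<bar> \<le> q * norm g * (1 / 2) ^ (length w + 1)" for g w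
  proof -
    have "bounded_linear (\<Lambda> w)"
      unfolding \<Lambda>_def[abs_def] using bounded_linear_compose[OF bounded_linear_block_mean[OF \<tau>] T] .
    moreover have "(\<Sum>v | word_rank v < word_rank w. \<bar>\<Lambda> w (R (haar_vector v))\<bar>) \<le> \<epsilon> w"
      using adm[of w] by (simp add: R(3))
    moreover have "\<bar>\<Lambda> w (R f)\<bar> \<le> \<epsilon> w * norm (R f)"
      if "\<And>v. haar_coeff f v \<noteq> 0 \<Longrightarrow> word_rank w < word_rank v" for f
    proof -
      have "supported_on (reserve (s w)) (R f)"
        by (rule R(4)) (use that nested in blast)
      then show ?thesis
        using adm[of w] by blast
    qed
    ultimately have "\<bar>\<Lambda> w (R g) - haar_coeff g w * d w\<bar> \<le> 2 * \<epsilon> w * norm g"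
      unfolding d_def by (rule functional_almost_diagonal[OF _ R(1,2)])
    moreover have "haar_coeff (U g - g) w = (\<Lambda> w (R g) - haar_coeff g w * d w) / d w"
      using d[of w] \<delta> by (simp add: U_def Q(2) \<Lambda>_def field_simps)
    ultimately have "\<bar>haar_coeff (U g - g) w\<bar> \<le> 2 * \<epsilon> w * norm g / \<delta>"
      using d[of w] \<delta> \<epsilon>[of w] by (auto simp: abs_divide intro!: frac_le)
    then show ?thesis
      using \<delta> by (simp add: \<epsilon>_def field_simps)
  qed
  have near: "norm (U g - g) \<le> q * norm g" for g
  proof -
    have "chain_square (haar_coeff (U g - g)) w \<le> (q * norm g)\<^sup>2" for w
    proof -
      have "chain_square (haar_coeff (U g - g)) w
          \<le> (\<Sum>j\<le>length w. (q * norm g * (1 / 2) ^ (j + 1))\<^sup>2)"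
        unfolding chain_square_def
      proof (rule sum_mono)
        fix j assume "j \<in> {..length w}"
        then have "\<bar>haar_coeff (U g - g) (take j w)\<bar> \<le> q * norm g * (1 / 2) ^ (j + 1)"
          using entry[of g "take j w"] by (simp add: min_absorb2)
        then have "\<bar>haar_coeff (U g - g) (take j w)\<bar>\<^sup>2 \<le> (q * norm g * (1 / 2) ^ (j + 1))\<^sup>2"
          by (rule power_mono) simp
        then show "(haar_coeff (U g - g) (take j w))\<^sup>2 \<le> (q * norm g * (1 / 2) ^ (j + 1))\<^sup>2"
          by simp
      qed
      also have "\<dots> = (q * norm g)\<^sup>2 * (\<Sum>j\<le>length w. ((1 / 2) ^ (j + 1))\<^sup>2)"
        unfolding sum_distrib_left by (intro sum.cong refl power_mult_distrib)
      also have "\<dots> \<le> (q * norm g)\<^sup>2 * 1"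
        by (intro mult_left_mono sum_power_half_square_le) simp
      finally show ?thesis by simp
    qed
    then show ?thesis
      using q by (subst norm_le_iff_chain_square) auto
  qed
  obtain V where V: "bounded_linear V" "V \<circ> U = id" "\<And>y. norm (V y) \<le> norm y / (1 - q)"
    using left_inverse_near_identity[OF complete_SL_inf U _ q(2) near] q(1) by auto
  have "norm (V (Q g)) \<le> (1 + \<eta>) / \<delta> * norm g" for g
  proof -
    have "norm (V (Q g)) \<le> (1 + \<eta>) * norm (Q g)"
      using V(3)[of "Q g"] q(3) by (metis mult.commute mult.right_neutral times_divide_eq_right)
    also have "\<dots> \<le> (1 + \<eta>) * (1 / \<delta> * norm g)"
      using \<eta> by (intro mult_left_mono Q(3)) simp
    finally show ?thesis by simp
  qed
  moreover have "(V \<circ> Q) \<circ> T \<circ> R = id"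
    using V(2) by (simp add: fun_eq_iff U_def)
  moreover have "bounded_linear (V \<circ> Q)"
    unfolding comp_def by (rule bounded_linear_compose[OF V(1) Q(1)])
  ultimately show ?thesis
    using R(1,2) by (intro exI[of _ R] exI[of _ "V \<circ> Q"]) simp
qed

theorem theorem2p1:
  fixes \<delta> \<eta> :: real and T :: "SL_inf \<Rightarrow> SL_inf"
  assumes "\<delta> > 0" and "\<eta> > 0"
    and "bounded_linear T"
    and "\<forall>I\<in>dyadic_intervals. \<bar>pairing (T (haar_series I)) I\<bar> \<ge> \<delta> * measure lebesgue I"
  shows "\<exists>R S :: SL_inf \<Rightarrow> SL_inf. bounded_linear R \<and> bounded_linear S \<and>
    S \<circ> T \<circ> R = id \<and> onorm R * onorm S \<le> (1 + \<eta>) / \<delta>"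
proof -
  have "\<delta> \<le> \<bar>haar_coeff (T (haar_vector K)) K\<bar>" for K
  proof -
    have "\<delta> * measure lebesgue (word_interval K)
        \<le> \<bar>pairing (T (haar_series (word_interval K))) (word_interval K)\<bar>"
      using assms(4) by simp
    then show ?thesis
      by (simp add: pairing_def haar_coeff_def haar_vector_def measure_word_interval abs_mult
          divide_le_cancel)
  qed
  from identity_factors_through_large_diagonal[OF assms(1-3) this]
  obtain R S :: "SL_inf \<Rightarrow> SL_inf" where RS: "bounded_linear R" "bounded_linear S" "S \<circ> T \<circ> R = id"
    "\<And>g. norm (R g) \<le> norm g" "\<And>g. norm (S g) \<le> (1 + \<eta>) / \<delta> * norm g"
    by blast
  have "onorm R \<le> 1"
    by (rule onorm_bound) (simp_all add: RS(4))
  moreover have "onorm S \<le> (1 + \<eta>) / \<delta>"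
    using assms(1,2) by (intro onorm_bound RS(5)) simp
  ultimately have "onorm R * onorm S \<le> 1 * ((1 + \<eta>) / \<delta>)"
    by (rule mult_mono) (simp_all add: onorm_pos_le RS(2))
  then have "onorm R * onorm S \<le> (1 + \<eta>) / \<delta>"
    by simp
  with RS(1-3) show ?thesis by blast
qed

end
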